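(* The generalized Zariski exponents are $\widetilde{\mathcal{A}}$-invariant. That is: fix $r\ge 1$ and a topological class $\{n,\lambda_1,\ldots,\lambda_g\}$, and let $H_1=(t_1^n,\ldots,t_r^n,S_1(\underline{t}))$ and $H_2=(t_1^n,\ldots,t_r^n,S_2(\underline{t}))$ be two quasi-short parameterizations with generalized characteristic exponents $\lambda_1,\ldots,\lambda_g$ (hence with the same semigroup $\Gamma$). If $H_1$ and $H_2$ are $\widetilde{\mathcal{A}}$-equivalent, then $E_{\mathcal{Z}}(H_1)=E_{\mathcal{Z}}(H_2)$.
   Context: Notation. $\mathbb{N}$ contains $0$; $\underline{t}=(t_1,\ldots,t_r)$, $\underline{X}=(X_1,\ldots,X_r)$, with multi-index notation for monomials. $\preceq$ is the product order on $\mathbb{N}^r$ ($\alpha\preceq\beta$ iff $\alpha_i\le\beta_i$ for all $i$), and $\alpha\prec\beta$ means $\alpha\preceq\beta$, $\alpha\ne\beta$. For $q=\sum c_\alpha\underline{t}^\alpha$, $supp(q)=\{\alpha: c_\alpha\neq 0\}$. Quasi-ordinary (q.o.) parameterization. Let $f\in\mathbb{C}\{\underline{X}\}[X_{r+1}]$ be an irreducible Weierstrass polynomial of degree $n$ whose discriminant with respect to $X_{r+1}$ is a monomial in $\underline{X}$ times a unit of $\mathbb{C}\{\underline{X}\}$. Its roots $\xi_1,\dots,\xi_n$ lie in $\mathbb{C}\{X_1^{1/n},\ldots,X_r^{1/n}\}$ and, for $i\ne j$, $\xi_i-\xi_j=\underline{X}^{\lambda(i,j)/n}u_{ij}$ with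 $u_{ij}$ a unit and $\lambda(i,j)\in\mathbb{N}^r$. The distinct $\lambda(i,j)$ are totally ordered, $\lambda_1\prec\cdots\prec\lambda_g$, and are called the generalized characteristic exponents; write $\lambda_k=(\lambda_{k1},\ldots,\lambda_{kr})$. Writing a root as $S(\underline{t})$ with $t_i=X_i^{1/n}$, the tuple $H=(t_1^n,\ldots,t_r^n,S(\underline{t}))$ is called a q.o. parameterization. $H$ is normalized if: (1) $S(\underline{t})=\underline{t}^{\lambda_1}u(\underline{t})$ with $u(\underline{0})=1$; (2) $(\lambda_{1i},\ldots,\lambda_{gi})\ge_{lex}(\lambda_{1j},\ldots,\lambda_{gj})$ for all $i<j$; (3) if $\lambda_1=(\lambda_{11},0,\ldots,0)$ then $\lambda_{11}>n$. The data $\{n,\lambda_1,\ldots,\lambda_g\}$ of a normalized parameterization determine, and are determined by, the topological class. Semigroup. Let $Q_0=n\mathbb{Z}^r$, $Q_i=Q_{i-1}+\lambda_i\mathbb{Z}$, $n_i=|Q_i:Q_{i-1}|$ (so $n_1\cdots n_g=n$). With $\theta_j$ the canonical basis of $\mathbb{R}^r$, put $\nu_j=n\theta_j$ ($1\le j\le r$), $\nu_{r+1}=\lambda_1$, $\nu_{r+i}=n_{i-1}\nu_{r+i-1}+\lambda_i-\lambda_{i-1}$ ($2\le i\le g$). The semigroup of $H$ is $\Gamma=\sum_{k=1}^{r+g}\nu_k\mathbb{N}\subseteq\mathbb{N}^r$. Quasi-short parameterizations and generalized Zariski exponents. A normalized q.o. parameterization $H=(t_1^n,\ldots,t_r^n,\underline{t}^{\lambda_1}+\sum_{\delta\succ\lambda_1}a_\delta\underline{t}^\delta)$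 is quasi-short if no element of $supp(\sum_{\delta\succ\lambda_1}a_\delta\underline{t}^\delta)$ belongs to $\Gamma\cup\bigcup_{1\le i\le r,\ \lambda_{1i}\ge n}(\Gamma+2\lambda_1-\nu_i)$. For $H$ quasi-short, $E_{\mathcal{Z}}(H)$ is the set of $\preceq$-minimal elements of $supp(\sum_{\delta\succ\lambda_1}a_\delta\underline{t}^\delta)$ if this support is nonempty (its elements are the generalized Zariski exponents of $H$), and $E_{\mathcal{Z}}(H)=\{\underline{\infty}\}$ otherwise. The group $\widetilde{\mathcal{A}}$ (for the fixed class $\{n,\lambda_1,\ldots,\lambda_g\}$). Let $\mathcal{M}_r$, $\mathcal{M}_{r+1}$ be the maximal ideals of $\mathbb{C}\{\underline{t}\}$, $\mathbb{C}\{\underline{X},X_{r+1}\}$. $\widetilde{\mathcal{A}}$ is the group of pairs $(\sigma,\rho)$ of germs of analytic isomorphisms of $(\mathbb{C}^{r+1},0)$ and $(\mathbb{C}^r,0)$ with $\rho=(t_1(c_1+\zeta_1),\ldots,t_r(c_r+\zeta_r))$, $\sigma_i=a_iX_i+X_i\epsilon_i+X_{r+1}\eta_i$ ($1\le i\le r$), $\sigma_{r+1}=a_{r+1}X_{r+1}+X_{r+1}\epsilon_{r+1}+\underline{X}^{\alpha}\eta_{r+1}$, where $\alpha=(\lceil\lambda_{11}/n\rceil,\ldots,\lceil\lambda_{1r}/n\rceil)$, $c_i,a_i,a_{r+1}\in\mathbb{C}\setminus\{0\}$, $\zeta_i\in\mathcal{M}_r$, $\epsilon_i,\epsilon_{r+1}\in\mathcal{M}_{r+1}$,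 $\eta_i,\eta_{r+1}\in\mathbb{C}\{\underline{X},X_{r+1}\}$, and $\eta_i=0$ if $n>\lambda_{1i}$ ($1\le i\le r$). $H_1,H_2$, regarded as map germs $(\mathbb{C}^r,0)\to(\mathbb{C}^{r+1},0)$, are $\widetilde{\mathcal{A}}$-equivalent if $H_2=\sigma\circ H_1\circ\rho^{-1}$ for some $(\sigma,\rho)\in\widetilde{\mathcal{A}}$. *)

theory Defs
  imports
    "HOL-Analysis.Analysis"
    "Subresultants.Resultant_Prelim"
begin

unbundle no fps_syntax
no_notation Matrix.vec_index (infixl \<open>$\<close> 100)

section \<open>The ring of convergent power series\<close>

text \<open>
  Multi-indices are vectors \<^typ>\<open>nat ^ 'v\<close>; the library order on them is the product order.
  A formal power series in the variables \<^typ>\<open>'v\<close> is its family of coefficients; it is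
  convergent if it converges absolutely at some point with all coordinates positive.
\<close>

definition ps_convergent :: "(nat ^ 'v::finite \<Rightarrow> complex) \<Rightarrow> bool" where
  "ps_convergent f \<longleftrightarrow>
     (\<exists>\<rho>>0. (\<lambda>\<alpha>. norm (f \<alpha>) * \<rho> ^ (\<Sum>i\<in>UNIV. \<alpha> $ i)) summable_on UNIV)"

lemma sum_axis_pow:
  fixes \<beta> \<gamma> :: "nat ^ 'v::finite" and \<rho> :: real
  shows "\<rho> ^ (\<Sum>i\<in>UNIV. (\<beta> + \<gamma>) $ i)
       = \<rho> ^ (\<Sum>i\<in>UNIV. \<beta> $ i) * \<rho> ^ (\<Sum>i\<in>UNIV. \<gamma> $ i)"
  by (simp add: sum.distrib power_add)

lemma ps_convergent_shrink:
  assumes "(\<lambda>\<alpha>. norm (f \<alpha>) * \<rho> ^ (\<Sum>i\<in>UNIV. \<alpha> $ i)) summable_on UNIV"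
    and "0 < \<rho>'" "\<rho>' \<le> (\<rho>::real)"
  shows "(\<lambda>\<alpha>::nat ^ 'v::finite. norm (f \<alpha> :: complex) * \<rho>' ^ (\<Sum>i\<in>UNIV. \<alpha> $ i)) summable_on UNIV"
  by (rule summable_on_comparison_test[OF assms(1)])
     (use assms(2,3) in \<open>auto intro!: mult_left_mono power_mono\<close>)

lemma ps_convergent_finite_support:
  assumes "finite {\<alpha>. f \<alpha> \<noteq> 0}"
  shows "ps_convergent f"
  unfolding ps_convergent_def
proof (intro exI[of _ 1] conjI)
  show "(\<lambda>\<alpha>. norm (f \<alpha>) * 1 ^ (\<Sum>i\<in>UNIV. \<alpha> $ i)) summable_on UNIV"
    by (rule summable_on_cong_neutral[THEN iffD1, OF _ _ _ summable_on_finite[OF assms]]) auto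
qed simp

lemma ps_convergent_add:
  assumes "ps_convergent f" "ps_convergent g"
  shows "ps_convergent (\<lambda>\<alpha>. f \<alpha> + g \<alpha>)"
proof -
  let ?s = "\<lambda>\<alpha>::nat^'a. \<Sum>i\<in>UNIV. \<alpha> $ i"
  obtain \<rho>1 where r1: "\<rho>1 > 0" "(\<lambda>\<alpha>. norm (f \<alpha>) * \<rho>1 ^ ?s \<alpha>) summable_on UNIV"
    using assms(1) unfolding ps_convergent_def by blast
  obtain \<rho>2 where r2: "\<rho>2 > 0" "(\<lambda>\<alpha>. norm (g \<alpha>) * \<rho>2 ^ ?s \<alpha>) summable_on UNIV"
    using assms(2) unfolding ps_convergent_def by blast
  define \<rho> where "\<rho> = min \<rho>1 \<rho>2"
  have r: "\<rho> > 0" using r1 r2 by (simp add: \<rho>_def)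
  have "(\<lambda>\<alpha>. norm (f \<alpha>) * \<rho> ^ ?s \<alpha> + norm (g \<alpha>) * \<rho> ^ ?s \<alpha>) summable_on UNIV"
    by (intro summable_on_add ps_convergent_shrink[OF r1(2)] ps_convergent_shrink[OF r2(2)])
       (use r in \<open>auto simp: \<rho>_def\<close>)
  then have "(\<lambda>\<alpha>. norm (f \<alpha> + g \<alpha>) * \<rho> ^ ?s \<alpha>) summable_on UNIV"
    by (rule summable_on_comparison_test)
       (use r in \<open>auto simp flip: distrib_right intro!: mult_right_mono norm_triangle_ineq\<close>)
  with r show ?thesis unfolding ps_convergent_def by blast
qed

lemma ps_convergent_uminus: "ps_convergent f \<Longrightarrow> ps_convergent (\<lambda>\<alpha>. - f \<alpha>)"
  by (simp add: ps_convergent_def)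

lemma finite_le_vec: "finite {\<beta>. \<beta> \<le> (\<alpha> :: nat ^ 'v::finite)}"
proof (rule finite_subset)
  show "{\<beta>. \<beta> \<le> \<alpha>} \<subseteq> vec_lambda ` (PiE UNIV (\<lambda>i. {..\<alpha> $ i}))"
  proof
    fix \<beta> assume "\<beta> \<in> {\<beta>. \<beta> \<le> \<alpha>}"
    then have "vec_nth \<beta> \<in> PiE UNIV (\<lambda>i. {..\<alpha> $ i})" by (auto simp: Finite_Cartesian_Product.less_eq_vec_def)
    then have "vec_lambda (vec_nth \<beta>) \<in> vec_lambda ` (PiE UNIV (\<lambda>i. {..\<alpha> $ i}))" by blast
    then show "\<beta> \<in> vec_lambda ` (PiE UNIV (\<lambda>i. {..\<alpha> $ i}))" by simp
  qed
qed (auto intro!: finite_PiE)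

lemma finite_add_eq_vec: "finite {(\<beta>, \<gamma>). \<beta> + \<gamma> = (\<alpha> :: nat ^ 'v::finite)}"
proof (rule finite_subset)
  show "{(\<beta>, \<gamma>). \<beta> + \<gamma> = \<alpha>} \<subseteq> {\<beta>. \<beta> \<le> \<alpha>} \<times> {\<beta>. \<beta> \<le> \<alpha>}"
    by (auto simp: Finite_Cartesian_Product.less_eq_vec_def)
qed (intro finite_cartesian_product finite_le_vec)

lemma ps_convergent_mult:
  assumes "ps_convergent f" "ps_convergent g"
  shows "ps_convergent (\<lambda>\<alpha>. \<Sum>(\<beta>, \<gamma>) | \<beta> + \<gamma> = \<alpha>. f \<beta> * g \<gamma>)"
proof -
  let ?s = "\<lambda>\<alpha>::nat^'a. \<Sum>i\<in>UNIV. \<alpha> $ i"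
  let ?P = "\<lambda>\<alpha>::nat^'a. {(\<beta>, \<gamma>). \<beta> + \<gamma> = \<alpha>}"
  obtain \<rho>1 where r1: "\<rho>1 > 0" "(\<lambda>\<alpha>. norm (f \<alpha>) * \<rho>1 ^ ?s \<alpha>) summable_on UNIV"
    using assms(1) unfolding ps_convergent_def by blast
  obtain \<rho>2 where r2: "\<rho>2 > 0" "(\<lambda>\<alpha>. norm (g \<alpha>) * \<rho>2 ^ ?s \<alpha>) summable_on UNIV"
    using assms(2) unfolding ps_convergent_def by blast
  define \<rho> where "\<rho> = min \<rho>1 \<rho>2"
  have r: "\<rho> > 0" using r1 r2 by (simp add: \<rho>_def)
  define a where "a \<alpha> = norm (f \<alpha>) * \<rho> ^ ?s \<alpha>" for \<alpha>
  define b where "b \<alpha> = norm (g \<alpha>) * \<rho> ^ ?s \<alpha>" for \<alpha>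
  have a: "a summable_on UNIV" unfolding a_def
    by (rule ps_convergent_shrink[OF r1(2)]) (use r in \<open>auto simp: \<rho>_def\<close>)
  have b: "b summable_on UNIV" unfolding b_def
    by (rule ps_convergent_shrink[OF r2(2)]) (use r in \<open>auto simp: \<rho>_def\<close>)
  have a0: "a \<alpha> \<ge> 0" and b0: "b \<alpha> \<ge> 0" for \<alpha> using r by (simp_all add: a_def b_def)
  let ?h = "\<lambda>\<alpha>. norm (\<Sum>(\<beta>, \<gamma>) | \<beta> + \<gamma> = \<alpha>. f \<beta> * g \<gamma>) * \<rho> ^ ?s \<alpha>"
  have bound: "sum ?h F \<le> infsum a UNIV * infsum b UNIV" if F: "finite F" for F
  proof -
    define B where "B = fst ` snd ` Sigma F ?P"
    define C where "C = snd ` snd ` Sigma F ?P"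
    have BC: "finite B" "finite C"
      unfolding B_def C_def by (intro finite_imageI finite_SigmaI F finite_add_eq_vec)+
    have "?h \<alpha> \<le> (\<Sum>(\<beta>, \<gamma>) \<in> ?P \<alpha>. a \<beta> * b \<gamma>)" for \<alpha>
    proof -
      have "?h \<alpha> \<le> (\<Sum>(\<beta>, \<gamma>) \<in> ?P \<alpha>. norm (f \<beta> * g \<gamma>)) * \<rho> ^ ?s \<alpha>"
        using r by (intro mult_right_mono) (auto simp: case_prod_unfold intro!: norm_sum)
      also have "\<dots> = (\<Sum>(\<beta>, \<gamma>) \<in> ?P \<alpha>. a \<beta> * b \<gamma>)"
        unfolding sum_distrib_right
        by (rule sum.cong) (auto simp: a_def b_def norm_mult sum_axis_pow simp del: vector_add_component)
      finally show ?thesis .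
    qed
    then have "sum ?h F \<le> (\<Sum>\<alpha>\<in>F. \<Sum>(\<beta>, \<gamma>) \<in> ?P \<alpha>. a \<beta> * b \<gamma>)" by (intro sum_mono)
    also have "\<dots> = (\<Sum>x\<in>Sigma F ?P. case snd x of (\<beta>, \<gamma>) \<Rightarrow> a \<beta> * b \<gamma>)"
    proof (subst sum.Sigma[OF F])
      show "\<forall>\<alpha>\<in>F. finite (?P \<alpha>)" by (intro ballI finite_add_eq_vec)
    qed (simp add: case_prod_unfold)
    also have "\<dots> = (\<Sum>(\<beta>, \<gamma>) \<in> snd ` Sigma F ?P. a \<beta> * b \<gamma>)"
      by (rule sum.reindex[unfolded o_def, symmetric]) (auto simp: inj_on_def)
    also have "\<dots> \<le> (\<Sum>(\<beta>, \<gamma>) \<in> B \<times> C. a \<beta> * b \<gamma>)"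
    proof (rule sum_mono2)
      show "finite (B \<times> C)" using BC by simp
      show "snd ` Sigma F ?P \<subseteq> B \<times> C" unfolding B_def C_def by force
    qed (auto simp: a0 b0)
    also have "\<dots> = sum a B * sum b C"
      by (simp add: sum_product sum.cartesian_product)
    also have "\<dots> \<le> infsum a UNIV * infsum b UNIV"
    proof (rule mult_mono)
      show "sum a B \<le> infsum a UNIV" using finite_sum_le_infsum[OF a BC(1)] a0 by simp
      show "sum b C \<le> infsum b UNIV" using finite_sum_le_infsum[OF b BC(2)] b0 by simp
      show "0 \<le> infsum a UNIV" by (rule infsum_nonneg) (rule a0)
      show "0 \<le> sum b C" by (rule sum_nonneg) (rule b0)
    qed
    finally show ?thesis .
  qed
  have "?h summable_on UNIV"
  proof (rule nonneg_bdd_above_summable_on)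
    show "0 \<le> ?h \<alpha>" for \<alpha> using r by simp
    show "bdd_above (sum ?h ` {F. F \<subseteq> UNIV \<and> finite F})"
      by (rule bdd_aboveI[of _ "infsum a UNIV * infsum b UNIV"]) (use bound in blast)
  qed
  with r show ?thesis unfolding ps_convergent_def by blast
qed

typedef (overloaded) ('v::finite) cps = "{f :: nat ^ 'v \<Rightarrow> complex. ps_convergent f}"
  morphisms cps_coeff Abs_cps
  by (rule exI[of _ "\<lambda>_. 0"]) (simp add: ps_convergent_finite_support)

setup_lifting type_definition_cps

instantiation cps :: (finite) comm_ring_1
begin

lift_definition zero_cps :: "'a cps" is "\<lambda>_. 0"
  by (simp add: ps_convergent_finite_support)

lift_definition one_cps :: "'a cps" is "\<lambda>\<alpha>. if \<alpha> = 0 then 1 else 0"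
  by (simp add: ps_convergent_finite_support)

lift_definition plus_cps :: "'a cps \<Rightarrow> 'a cps \<Rightarrow> 'a cps" is "\<lambda>f g \<alpha>. f \<alpha> + g \<alpha>"
  by (rule ps_convergent_add)

lift_definition uminus_cps :: "'a cps \<Rightarrow> 'a cps" is "\<lambda>f \<alpha>. - f \<alpha>"
  by (rule ps_convergent_uminus)

lift_definition minus_cps :: "'a cps \<Rightarrow> 'a cps \<Rightarrow> 'a cps" is "\<lambda>f g \<alpha>. f \<alpha> - g \<alpha>"
  by (subst diff_conv_add_uminus) (intro ps_convergent_add ps_convergent_uminus)

lift_definition times_cps :: "'a cps \<Rightarrow> 'a cps \<Rightarrow> 'a cps"
  is "\<lambda>f g \<alpha>. \<Sum>(\<beta>, \<gamma>) | \<beta> + \<gamma> = \<alpha>. f \<beta> * g \<gamma>"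
  by (rule ps_convergent_mult)

instance
proof
  fix a b c :: "'a cps"
  show "a * b * c = a * (b * c)"
  proof (transfer, rule ext)
    fix f g h :: "nat ^ 'a \<Rightarrow> complex" and \<alpha> :: "nat ^ 'a"
    let ?P = "\<lambda>\<alpha>::nat^'a. {(\<beta>, \<gamma>). \<beta> + \<gamma> = \<alpha>}"
    have "(\<Sum>(\<delta>, \<gamma>) \<in> ?P \<alpha>. (\<Sum>(\<beta>, \<epsilon>) \<in> ?P \<delta>. f \<beta> * g \<epsilon>) * h \<gamma>)
        = (\<Sum>x \<in> ?P \<alpha>. \<Sum>y \<in> ?P (fst x). f (fst y) * g (snd y) * h (snd x))"
      by (simp add: case_prod_unfold sum_distrib_right)
    also have "\<dots> = (\<Sum>(x, y) \<in> Sigma (?P \<alpha>) (\<lambda>x. ?P (fst x)). f (fst y) * g (snd y) * h (snd x))"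
      by (rule sum.Sigma) (intro ballI finite_add_eq_vec)+
    also have "\<dots> = (\<Sum>(x, y) \<in> Sigma (?P \<alpha>) (\<lambda>x. ?P (snd x)). f (fst x) * g (fst y) * h (snd y))"
      by (rule sum.reindex_bij_witness
            [of _ "\<lambda>((\<beta>, \<delta>), (\<epsilon>, \<gamma>)). ((\<beta> + \<epsilon>, \<gamma>), (\<beta>, \<epsilon>))" "\<lambda>((\<delta>, \<gamma>), (\<beta>, \<epsilon>)). ((\<beta>, \<epsilon> + \<gamma>), (\<epsilon>, \<gamma>))"])
         (auto simp: add.assoc)
    also have "\<dots> = (\<Sum>x \<in> ?P \<alpha>. \<Sum>y \<in> ?P (snd x). f (fst x) * g (fst y) * h (snd y))"
      by (rule sum.Sigma[symmetric]) (intro ballI finite_add_eq_vec)+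
    also have "\<dots> = (\<Sum>(\<beta>, \<delta>) \<in> ?P \<alpha>. f \<beta> * (\<Sum>(\<epsilon>, \<gamma>) \<in> ?P \<delta>. g \<epsilon> * h \<gamma>))"
      by (simp add: case_prod_unfold sum_distrib_left mult.assoc)
    finally show "(\<Sum>(\<delta>, \<gamma>) \<in> ?P \<alpha>. (\<Sum>(\<beta>, \<epsilon>) \<in> ?P \<delta>. f \<beta> * g \<epsilon>) * h \<gamma>)
        = (\<Sum>(\<beta>, \<delta>) \<in> ?P \<alpha>. f \<beta> * (\<Sum>(\<epsilon>, \<gamma>) \<in> ?P \<delta>. g \<epsilon> * h \<gamma>))" .
  qed
  show "a * b = b * a"
    by (transfer, rule ext,
        rule sum.reindex_bij_witness[of _ "\<lambda>(x, y). (y, x)" "\<lambda>(x, y). (y, x)"])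
       (auto simp: add.commute mult.commute)
  show "1 * a = a"
  proof (transfer, rule ext)
    fix f :: "nat ^ 'a \<Rightarrow> complex" and \<alpha> :: "nat ^ 'a"
    have "(\<Sum>(\<beta>, \<gamma>) | \<beta> + \<gamma> = \<alpha>. (if \<beta> = 0 then 1 else 0) * f \<gamma>)
        = (\<Sum>(\<beta>, \<gamma>) \<in> {(0 :: nat ^ 'a, \<alpha>)}. (if \<beta> = 0 then 1 else 0) * f \<gamma>)"
      by (rule sum.mono_neutral_right) (use finite_add_eq_vec in \<open>auto split: if_splits\<close>)
    then show "(\<Sum>(\<beta>, \<gamma>) | \<beta> + \<gamma> = \<alpha>. (if \<beta> = 0 then 1 else 0) * f \<gamma>) = f \<alpha>" by simp
  qed
  show "(a + b) * c = a * c + b * c"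
    by (transfer, rule ext) (simp add: case_prod_unfold distrib_right sum.distrib)
  show "a + b + c = a + (b + c)" "a + b = b + a" "0 + a = a" "- a + a = 0" "a - b = a + - b"
    by (transfer; simp add: algebra_simps)+
  show "(0 :: 'a cps) \<noteq> 1"
    by transfer (metis zero_neq_one)
qed

end

text \<open>
  Shrinking the supports of two series to the exponents minimizing one coordinate after the other
  leaves a single exponent in each, and the product of their coefficients is the only contribution
  to a coefficient of the product.
\<close>

lemma leading_exponents:
  fixes A B :: "(nat ^ 'v::finite) set"
  assumes "finite V" "A \<noteq> {}" "B \<noteq> {}"
  shows "\<exists>A'\<subseteq>A. \<exists>B'\<subseteq>B. A' \<noteq> {} \<and> B' \<noteq> {} \<and>
    (\<forall>\<alpha>\<in>A'. \<forall>\<alpha>'\<in>A'. \<forall>v\<in>V. \<alpha> $ v = \<alpha>' $ v) \<and> (\<forall>\<beta>\<in>B'. \<forall>\<beta>'\<in>B'. \<forall>v\<in>V. \<beta> $ v = \<beta>' $ v) \<and>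
    (\<forall>\<alpha>\<in>A. \<forall>\<beta>\<in>B. \<forall>\<alpha>'\<in>A'. \<forall>\<beta>'\<in>B'. \<alpha> + \<beta> = \<alpha>' + \<beta>' \<longrightarrow> \<alpha> \<in> A' \<and> \<beta> \<in> B')"
  using assms(1)
proof (induction V)
  case empty
  then show ?case using assms(2,3) by (intro exI[of _ A] exI[of _ B] conjI) auto
next
  case (insert v V)
  from insert.IH obtain A' B' where AB: "A' \<subseteq> A" "B' \<subseteq> B" "A' \<noteq> {}" "B' \<noteq> {}"
    "\<forall>\<alpha>\<in>A'. \<forall>\<alpha>'\<in>A'. \<forall>v\<in>V. \<alpha> $ v = \<alpha>' $ v" "\<forall>\<beta>\<in>B'. \<forall>\<beta>'\<in>B'. \<forall>v\<in>V. \<beta> $ v = \<beta>' $ v"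
    "\<forall>\<alpha>\<in>A. \<forall>\<beta>\<in>B. \<forall>\<alpha>'\<in>A'. \<forall>\<beta>'\<in>B'. \<alpha> + \<beta> = \<alpha>' + \<beta>' \<longrightarrow> \<alpha> \<in> A' \<and> \<beta> \<in> B'"
    by (elim exE conjE) (rule that; assumption)
  obtain a where a: "a \<in> A'" "\<And>\<alpha>. \<alpha> \<in> A' \<Longrightarrow> a $ v \<le> \<alpha> $ v"
    using AB(3) ex_has_least_nat[of "\<lambda>\<alpha>. \<alpha> \<in> A'" _ "\<lambda>\<alpha>. \<alpha> $ v"] by blast
  obtain b where b: "b \<in> B'" "\<And>\<alpha>. \<alpha> \<in> B' \<Longrightarrow> b $ v \<le> \<alpha> $ v"
    using AB(4) ex_has_least_nat[of "\<lambda>\<alpha>. \<alpha> \<in> B'" _ "\<lambda>\<alpha>. \<alpha> $ v"] by blast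
  let ?A = "{\<alpha>\<in>A'. \<alpha> $ v = a $ v}" and ?B = "{\<beta>\<in>B'. \<beta> $ v = b $ v}"
  have *: "\<alpha> \<in> ?A \<and> \<beta> \<in> ?B"
    if "\<alpha> \<in> A" "\<beta> \<in> B" "\<alpha>' \<in> ?A" "\<beta>' \<in> ?B" "\<alpha> + \<beta> = \<alpha>' + \<beta>'" for \<alpha> \<beta> \<alpha>' \<beta>'
  proof -
    have "\<alpha> \<in> A'" "\<beta> \<in> B'" using that AB(7) by blast+
    moreover have "\<alpha> $ v + \<beta> $ v = a $ v + b $ v"
      using that(3,4) arg_cong[OF that(5), of "\<lambda>x. x $ v"] by simp
    ultimately show ?thesis using a(2)[of \<alpha>] b(2)[of \<beta>] by simp
  qed
  have "?A \<subseteq> A" "?B \<subseteq> B" "?A \<noteq> {}" "?B \<noteq> {}"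
    using AB(1,2) a(1) b(1) by blast+
  have "\<forall>\<alpha>\<in>?A. \<forall>\<alpha>'\<in>?A. \<forall>w\<in>insert v V. \<alpha> $ w = \<alpha>' $ w"
    using AB(5) by fastforce
  have "\<forall>\<beta>\<in>?B. \<forall>\<beta>'\<in>?B. \<forall>w\<in>insert v V. \<beta> $ w = \<beta>' $ w"
    using AB(6) by fastforce
  show ?case
    by (rule exI[of _ ?A], rule conjI, fact, rule exI[of _ ?B], intro conjI;
        (fact | intro ballI impI, rule *; assumption))
qed

instance cps :: (finite) idom
proof
  fix a b :: "'a cps"
  assume "a \<noteq> 0" "b \<noteq> 0"
  then show "a * b \<noteq> 0"
  proof transfer
    fix f g :: "nat ^ 'a \<Rightarrow> complex"
    assume "f \<noteq> (\<lambda>_. 0)" "g \<noteq> (\<lambda>_. 0)"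
    then have "{\<alpha>. f \<alpha> \<noteq> 0} \<noteq> {}" "{\<alpha>. g \<alpha> \<noteq> 0} \<noteq> {}" by auto
    from leading_exponents[OF finite[of UNIV] this]
    obtain A B where AB:
      "A \<subseteq> {\<alpha>. f \<alpha> \<noteq> 0}" "B \<subseteq> {\<alpha>. g \<alpha> \<noteq> 0}" "A \<noteq> {}" "B \<noteq> {}"
      "\<forall>\<alpha>\<in>A. \<forall>\<alpha>'\<in>A. \<forall>v\<in>UNIV. \<alpha> $ v = \<alpha>' $ v" "\<forall>\<beta>\<in>B. \<forall>\<beta>'\<in>B. \<forall>v\<in>UNIV. \<beta> $ v = \<beta>' $ v"
      "\<forall>\<alpha>\<in>{\<alpha>. f \<alpha> \<noteq> 0}. \<forall>\<beta>\<in>{\<alpha>. g \<alpha> \<noteq> 0}. \<forall>\<alpha>'\<in>A. \<forall>\<beta>'\<in>B.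
         \<alpha> + \<beta> = \<alpha>' + \<beta>' \<longrightarrow> \<alpha> \<in> A \<and> \<beta> \<in> B"
      by (elim exE conjE) (rule that; assumption)
    obtain \<alpha> \<beta> where ab: "\<alpha> \<in> A" "\<beta> \<in> B" using AB(3,4) by blast
    have uniq: "\<beta>' = \<alpha> \<and> \<gamma> = \<beta>" if "f \<beta>' \<noteq> 0" "g \<gamma> \<noteq> 0" "\<beta>' + \<gamma> = \<alpha> + \<beta>" for \<beta>' \<gamma>
    proof -
      have "\<beta>' \<in> A" "\<gamma> \<in> B" using AB(7) ab that by blast+
      then have "\<forall>v. \<beta>' $ v = \<alpha> $ v" "\<forall>v. \<gamma> $ v = \<beta> $ v" using AB(5,6) ab by blast+
      then show ?thesis by (simp add: Finite_Cartesian_Product.vec_eq_iff)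
    qed
    have "(\<Sum>(\<beta>', \<gamma>) | \<beta>' + \<gamma> = \<alpha> + \<beta>. f \<beta>' * g \<gamma>) = (\<Sum>(\<beta>', \<gamma>) \<in> {(\<alpha>, \<beta>)}. f \<beta>' * g \<gamma>)"
      by (rule sum.mono_neutral_right[OF finite_add_eq_vec]) (use uniq in auto)
    moreover have "\<dots> \<noteq> 0" using ab AB(1,2) by auto
    ultimately show "(\<lambda>\<alpha>. \<Sum>(\<beta>, \<gamma>) | \<beta> + \<gamma> = \<alpha>. f \<beta> * g \<gamma>) \<noteq> (\<lambda>_. 0)" by metis
  qed
qed

lift_definition cps_monom :: "nat ^ 'v::finite \<Rightarrow> 'v cps" is "\<lambda>\<mu> \<alpha>. if \<alpha> = \<mu> then 1 else 0"
  by (simp add: ps_convergent_finite_support)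

lift_definition cps_const :: "complex \<Rightarrow> 'v::finite cps" is "\<lambda>c \<alpha>. if \<alpha> = 0 then c else 0"
  by (rule ps_convergent_finite_support, rule finite_subset[of _ "{0}"]) auto

definition cps_var :: "'v::finite \<Rightarrow> 'v cps" where
  "cps_var v = cps_monom (axis v 1)"

definition cps_supp :: "'v::finite cps \<Rightarrow> (nat ^ 'v) set" where
  "cps_supp f = {\<alpha>. cps_coeff f \<alpha> \<noteq> 0}"

definition cps_max_ideal :: "'v::finite cps set" where
  "cps_max_ideal = {f. cps_coeff f 0 = 0}"

text \<open>
  The value is meaningful only where the series converges absolutely, in particular near the
  origin; all uses below concern germs at the origin, that is, hold eventually in \<^term>\<open>nhds 0\<close>.
\<close>

definition cps_eval :: "'v::finite cps \<Rightarrow> complex ^ 'v \<Rightarrow> complex" where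
  "cps_eval f x = (\<Sum>\<^sub>\<infinity>\<alpha>. cps_coeff f \<alpha> * (\<Prod>i\<in>UNIV. x $ i ^ (\<alpha> $ i)))"

definition germ_eval :: "('v::finite cps) ^ ('w::finite) \<Rightarrow> complex ^ 'v \<Rightarrow> complex ^ 'w" where
  "germ_eval F x = (\<chi> j. cps_eval (F $ j) x)"


section \<open>Quasi-ordinary parameterizations\<close>

text \<open>
  The indices \<open>1 < \<dots> < r\<close> are the elements of a finite linearly ordered type \<^typ>\<open>'r\<close>.
  The coordinates \<open>X\<^sub>1, \<dots>, X\<^sub>r, X\<^bsub>r+1\<^esub>\<close> of the target are indexed by \<^typ>\<open>'r option\<close>,
  with \<^term>\<open>None\<close> for \<open>X\<^bsub>r+1\<^esub>\<close>.
\<close>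

text \<open>Only used for monic polynomials, so no division by the leading coefficient.\<close>

definition discriminant :: "'a::idom poly \<Rightarrow> 'a" where
  "discriminant f = (- 1) ^ (degree f * (degree f - 1) div 2) * resultant f (pderiv f)"

definition weierstrass_poly :: "'r::finite cps poly \<Rightarrow> bool" where
  "weierstrass_poly f \<longleftrightarrow> lead_coeff f = 1 \<and> (\<forall>k<degree f. coeff f k \<in> cps_max_ideal)"

definition qo_poly :: "nat \<Rightarrow> 'r::finite cps poly \<Rightarrow> bool" where
  "qo_poly n f \<longleftrightarrow> weierstrass_poly f \<and> irreducible f \<and> degree f = n \<and>
     (\<exists>\<mu> u. u dvd 1 \<and> discriminant f = cps_monom \<mu> * u)"

text \<open>The roots of \<open>f\<close>, written in the variables \<open>t\<^sub>i = X\<^sub>i\<^bsup>1/n\<^esup>\<close>: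
  all \<open>\<xi>(t)\<close> with \<open>f(t\<^sub>1\<^sup>n, \<dots>, t\<^sub>r\<^sup>n, \<xi>(t)) = 0\<close>.\<close>

definition qo_roots :: "nat \<Rightarrow> 'r::finite cps poly \<Rightarrow> 'r cps set" where
  "qo_roots n f = {\<xi>. \<forall>\<^sub>F t in nhds 0.
     poly (map_poly (\<lambda>c. cps_eval c (\<chi> i. t $ i ^ n)) f) (cps_eval \<xi> t) = 0}"

definition char_exponents :: "nat \<Rightarrow> 'r::finite cps poly \<Rightarrow> (nat ^ 'r) set" where
  "char_exponents n f = {\<mu>. \<exists>\<xi>\<in>qo_roots n f. \<exists>\<xi>'\<in>qo_roots n f. \<xi> \<noteq> \<xi>' \<and>
     (\<exists>u. u dvd 1 \<and> \<xi> - \<xi>' = cps_monom \<mu> * u)}"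

text \<open>
  \<open>(t\<^sub>1\<^sup>n, \<dots>, t\<^sub>r\<^sup>n, S(t))\<close> is a quasi-ordinary parameterization with generalized
  characteristic exponents \<open>\<lambda>\<^sub>1 \<prec> \<dots> \<prec> \<lambda>\<^sub>g\<close>. Only the values \<open>lam 1, \<dots>, lam g\<close> of \<open>lam\<close> matter.
\<close>

definition qo_parameterization :: "nat \<Rightarrow> nat \<Rightarrow> (nat \<Rightarrow> nat ^ 'r::finite) \<Rightarrow> 'r cps \<Rightarrow> bool" where
  "qo_parameterization n g lam S \<longleftrightarrow>
     (\<exists>f. qo_poly n f \<and> S \<in> qo_roots n f \<and> char_exponents n f = lam ` {1..g}) \<and>
     strict_mono_on {1..g} lam"

definition normalized ::
  "nat \<Rightarrow> nat \<Rightarrow> (nat \<Rightarrow> nat ^ 'r::{finite,linorder}) \<Rightarrow> 'r cps \<Rightarrow> bool" where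
  "normalized n g lam S \<longleftrightarrow>
     qo_parameterization n g lam S \<and> 1 \<le> g \<and>
     (\<exists>u. S = cps_monom (lam 1) * u \<and> cps_coeff u 0 = 1) \<and>
     (\<forall>i j. i < j \<longrightarrow> ord_class.lexordp_eq (map (\<lambda>k. lam k $ j) [1..<g+1])
                                        (map (\<lambda>k. lam k $ i) [1..<g+1])) \<and>
     ((\<forall>i. i \<noteq> Min UNIV \<longrightarrow> lam 1 $ i = 0) \<longrightarrow> lam 1 $ Min UNIV > n)"


section \<open>The semigroup\<close>

primrec exp_lattice :: "nat \<Rightarrow> (nat \<Rightarrow> nat ^ 'r::finite) \<Rightarrow> nat \<Rightarrow> (int ^ 'r) set" where
  "exp_lattice n lam 0 = {int n *s z | z. True}"
| "exp_lattice n lam (Suc k) =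
     {q + m *s (\<chi> i. int (lam (Suc k) $ i)) | q m. q \<in> exp_lattice n lam k}"

text \<open>The index \<open>n\<^sub>k = |Q\<^sub>k : Q\<^bsub>k-1\<^esub>|\<close>, for \<open>k \<ge> 1\<close>.\<close>

definition exp_index :: "nat \<Rightarrow> (nat \<Rightarrow> nat ^ 'r::finite) \<Rightarrow> nat \<Rightarrow> nat" where
  "exp_index n lam k =
     card (exp_lattice n lam k // {(x, y). x \<in> exp_lattice n lam k \<and> y \<in> exp_lattice n lam k \<and>
                                          x - y \<in> exp_lattice n lam (k - 1)})"

definition nu_axis :: "nat \<Rightarrow> 'r::finite \<Rightarrow> nat ^ 'r" where
  "nu_axis n j = axis j n"

text \<open>\<open>nu_char n lam i\<close> is \<open>\<nu>\<^bsub>r+i\<^esub>\<close> for \<open>i \<ge> 1\<close>; the value at \<open>0\<close> is a dummy.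
  The subtraction of natural numbers is exact, since \<open>\<lambda>\<^bsub>i-1\<^esub> \<prec> \<lambda>\<^sub>i\<close>.\<close>

fun nu_char :: "nat \<Rightarrow> (nat \<Rightarrow> nat ^ 'r::finite) \<Rightarrow> nat \<Rightarrow> nat ^ 'r" where
  "nu_char n lam 0 = 0"
| "nu_char n lam (Suc 0) = lam 1"
| "nu_char n lam (Suc (Suc k)) =
     exp_index n lam (Suc k) *s nu_char n lam (Suc k) + lam (Suc (Suc k)) - lam (Suc k)"

definition qo_semigroup :: "nat \<Rightarrow> nat \<Rightarrow> (nat \<Rightarrow> nat ^ 'r::finite) \<Rightarrow> (nat ^ 'r) set" where
  "qo_semigroup n g lam =
     {(\<Sum>j\<in>UNIV. c j *s nu_axis n j) + (\<Sum>i=1..g. d i *s nu_char n lam i) | c d. True}"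


section \<open>Quasi-short parameterizations and generalized Zariski exponents\<close>

text \<open>For \<open>S = t\<^bsup>\<mu>\<^esup> + \<Sum>\<^bsub>\<delta> \<succ> \<mu>\<^esub> a\<^sub>\<delta> t\<^bsup>\<delta>\<^esup>\<close>, the support of the sum over \<open>\<delta> \<succ> \<mu>\<close>.\<close>

definition tail_supp :: "nat ^ 'r::finite \<Rightarrow> 'r cps \<Rightarrow> (nat ^ 'r) set" where
  "tail_supp \<mu> S = {\<delta> \<in> cps_supp S. \<mu> < \<delta>}"

text \<open>Membership of \<open>\<delta>\<close> in \<open>\<Gamma> + 2 \<lambda>\<^sub>1 - \<nu>\<^sub>i\<close> is stated as \<open>\<delta> + \<nu>\<^sub>i = \<gamma> + 2 \<lambda>\<^sub>1\<close> with \<open>\<gamma> \<in> \<Gamma>\<close>.\<close>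

definition quasi_short ::
  "nat \<Rightarrow> nat \<Rightarrow> (nat \<Rightarrow> nat ^ 'r::{finite,linorder}) \<Rightarrow> 'r cps \<Rightarrow> bool" where
  "quasi_short n g lam S \<longleftrightarrow>
     normalized n g lam S \<and>
     (\<forall>\<delta>\<in>tail_supp (lam 1) S.
        \<delta> \<notin> qo_semigroup n g lam \<and>
        \<not> (\<exists>i. lam 1 $ i \<ge> n \<and>
               (\<exists>\<gamma>\<in>qo_semigroup n g lam. \<delta> + nu_axis n i = \<gamma> + 2 *s lam 1)))"

definition zariski_exponents :: "nat ^ 'r::finite \<Rightarrow> 'r cps \<Rightarrow> (enat ^ 'r) set" where
  "zariski_exponents \<mu> S =
     (if tail_supp \<mu> S = {} then {\<chi> i. \<infinity>}
      else (\<lambda>\<delta>. \<chi> i. enat (\<delta> $ i)) ` {\<delta> \<in> tail_supp \<mu> S. \<not> (\<exists>\<beta>\<in>tail_supp \<mu> S. \<beta> < \<delta>)})"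


section \<open>The group of admissible coordinate changes\<close>

text \<open>
  An analytic germ \<open>(\<complex>\<^bsup>v\<^esup>, 0) \<rightarrow> (\<complex>\<^bsup>w\<^esup>, 0)\<close> is the tuple of its component series, none of which
  has a constant term. It is an isomorphism if it has a two-sided inverse of the same kind.
\<close>

definition inverse_germs :: "('v::finite cps) ^ 'v \<Rightarrow> ('v cps) ^ 'v \<Rightarrow> bool" where
  "inverse_germs F G \<longleftrightarrow>
     (\<forall>j. F $ j \<in> cps_max_ideal \<and> G $ j \<in> cps_max_ideal) \<and>
     (\<forall>\<^sub>F x in nhds 0. germ_eval G (germ_eval F x) = x) \<and>
     (\<forall>\<^sub>F x in nhds 0. germ_eval F (germ_eval G x) = x)"

definition A_tilde :: "nat \<Rightarrow> nat ^ 'r::finite \<Rightarrow>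
    ((('r option) cps ^ ('r option)) \<times> (('r cps) ^ 'r)) set" where
  "A_tilde n \<mu> = {(\<sigma>, \<rho>).
     (\<exists>\<tau>. inverse_germs \<sigma> \<tau>) \<and> (\<exists>\<tau>. inverse_germs \<rho> \<tau>) \<and>
     (\<exists>c \<zeta>. \<forall>i. c i \<noteq> 0 \<and> \<zeta> i \<in> cps_max_ideal \<and>
        \<rho> $ i = cps_var i * (cps_const (c i) + \<zeta> i)) \<and>
     (\<exists>a \<epsilon> \<eta>. (\<forall>j. a j \<noteq> 0 \<and> \<epsilon> j \<in> cps_max_ideal) \<and>
        (\<forall>i. \<sigma> $ Some i = cps_const (a (Some i)) * cps_var (Some i)
                + cps_var (Some i) * \<epsilon> (Some i) + cps_var None * \<eta> (Some i)) \<and>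
        (\<forall>i. n > \<mu> $ i \<longrightarrow> \<eta> (Some i) = 0) \<and>
        \<sigma> $ None = cps_const (a None) * cps_var None + cps_var None * \<epsilon> None
          + cps_monom (\<chi> j. case j of None \<Rightarrow> 0 | Some i \<Rightarrow> nat \<lceil>real (\<mu> $ i) / real n\<rceil>) * \<eta> None)}"

definition qo_map :: "nat \<Rightarrow> 'r::finite cps \<Rightarrow> ('r cps) ^ ('r option)" where
  "qo_map n S = (\<chi> j. case j of None \<Rightarrow> S | Some i \<Rightarrow> cps_var i ^ n)"

text \<open>\<open>H\<^sub>2 = \<sigma> \<circ> H\<^sub>1 \<circ> \<rho>\<^bsup>-1\<^esup>\<close> as map germs, where \<open>\<rho>'\<close> plays the role of \<open>\<rho>\<^bsup>-1\<^esup>\<close>.\<close>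

definition A_tilde_equiv :: "nat \<Rightarrow> nat ^ 'r::finite \<Rightarrow>
    ('r cps) ^ ('r option) \<Rightarrow> ('r cps) ^ ('r option) \<Rightarrow> bool" where
  "A_tilde_equiv n \<mu> H1 H2 \<longleftrightarrow>
     (\<exists>(\<sigma>, \<rho>) \<in> A_tilde n \<mu>. \<exists>\<rho>'. inverse_germs \<rho> \<rho>' \<and>
        (\<forall>\<^sub>F t in nhds 0. germ_eval H2 t = germ_eval \<sigma> (germ_eval H1 (germ_eval \<rho>' t))))"

end

theory Submission
  imports Defs
begin

text \<open>
  Write \<open>\<mu> = \<lambda>\<^sub>1\<close>, and let \<open>\<delta>\<close> be minimal among all exponents occurring in the tails of \<open>S\<^sub>1\<close> and \<open>S\<^sub>2\<close>
  together. If every such \<open>\<delta>\<close> occurs in both tails, the two tails have the same minimal elements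
  (\<open>minimal_elements_eqI\<close>), so everything rests on comparing the coefficients of \<open>S\<^sub>1\<close> and \<open>S\<^sub>2\<close> at \<open>\<delta>\<close>.

  Equivalence means \<open>H\<^sub>2 \<circ> \<rho> = \<sigma> \<circ> H\<^sub>1\<close>, with \<open>\<rho>\<^sub>i = t\<^sub>i v\<^sub>i\<close> and \<open>v\<^sub>i\<close> a unit. By the identity theorem
  for power series (\<open>cps_eqI\<close>) and the existence of composite series (\<open>cps_eval_comp\<close>) this is a
  system of identities between power series. Its last component is
  \<open>S\<^sub>2 \<circ> \<rho> = S\<^sub>1 \<cdot> (a + \<dots>) + t\<^bsup>n\<alpha>\<^esup> \<cdot> (\<dots>)\<close>, where the dots are series in \<open>t\<^sub>1\<^sup>n, \<dots>, t\<^sub>r\<^sup>n, S\<^sub>1\<close>.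
  Up to \<open>\<delta>\<close> the series \<open>S\<^sub>1\<close> is \<open>t\<^sup>\<mu> + s\<^sub>1t\<^sup>\<delta>\<close>, hence up to \<open>\<delta>\<close> the right-hand side has exponents in the
  monoid \<open>\<Gamma>'\<close> generated by \<open>\<mu>\<close> and the \<open>n\<theta>\<^sub>j\<close>, apart from the term \<open>a s\<^sub>1t\<^sup>\<delta>\<close>; quasi-shortness gives
  \<open>\<delta> \<notin> \<Gamma>'\<close>. The left-hand side is \<open>t\<^sup>\<mu>P + s\<^sub>2v(0)\<^sup>\<delta>t\<^sup>\<delta>\<close> up to \<open>\<delta>\<close>, where \<open>P = v\<^sup>\<mu> = \<Prod>\<^sub>i v\<^sub>i\<^bsup>\<mu>\<^sub>i\<^esup>\<close>. So if the
  coefficient of \<open>P\<close> at \<open>\<delta> - \<mu>\<close> vanishes, then \<open>s\<^sub>2v(0)\<^sup>\<delta> = a s\<^sub>1\<close>, and \<open>s\<^sub>1, s\<^sub>2\<close> vanish together.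

  That vanishing is the heart of the matter (\<open>unit_factors_vanish\<close>). The other components of the
  system say that up to \<open>\<delta> - \<mu>\<close> the series \<open>v\<^sub>i\<^sup>n\<close> has exponents in \<open>\<Gamma>'\<close>, and if \<open>\<mu>\<^sub>i \<ge> n\<close> also in
  \<open>\<mu> - n\<theta>\<^sub>i + \<Gamma>'\<close>. Quasi-shortness excludes \<open>\<delta> - \<mu>\<close> from these sets, but not from the sums of several
  exponents of the second kind. The remedy is that exponents of the second kind outside \<open>\<Gamma>'\<close> do not
  occur at all. A minimal one, \<open>\<beta>\<close>, belongs to a single index \<open>i\<close> (\<open>char_shift_unique\<close>), so it shows
  up undisturbed in \<open>P\<^sup>n = \<Prod>\<^sub>i (v\<^sub>i\<^sup>n)\<^bsup>\<mu>\<^sub>i\<^esup>\<close>, hence in \<open>P\<close>.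
  But \<open>\<mu> + \<beta>\<close> is below \<open>\<delta>\<close> and outside \<open>\<Gamma>'\<close> (\<open>char_shift_plus\<close>), where the last component forces \<open>t\<^sup>\<mu>P\<close>
  to have coefficient \<open>0\<close>.
\<close>

(* Two summability predicates share this infix; below it denotes that of Infinite_Sum. *)
no_notation Infinite_Set_Sum.abs_summable_on (infix \<open>abs'_summable'_on\<close> 50)

section \<open>Evaluating convergent series\<close>

abbreviation monom_value :: "'a::comm_monoid_mult ^ 'v::finite \<Rightarrow> nat ^ 'v \<Rightarrow> 'a" where
  "monom_value x \<alpha> \<equiv> (\<Prod>i\<in>UNIV. x $ i ^ (\<alpha> $ i))"

abbreviation vdeg :: "nat ^ 'v::finite \<Rightarrow> nat" where
  "vdeg \<alpha> \<equiv> (\<Sum>i\<in>UNIV. \<alpha> $ i)"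

definition cps_conv :: "'v::finite cps \<Rightarrow> real \<Rightarrow> bool" where
  "cps_conv f r \<longleftrightarrow> 0 < r \<and> (\<lambda>\<alpha>. norm (cps_coeff f \<alpha>) * r ^ vdeg \<alpha>) summable_on UNIV"

text \<open>The weighted \<open>\<ell>\<^sup>1\<close>-norm, submultiplicative on the series that converge absolutely at \<open>(r, \<dots>, r)\<close>.\<close>

definition cps_norm :: "'v::finite cps \<Rightarrow> real \<Rightarrow> real" where
  "cps_norm f r = (\<Sum>\<^sub>\<infinity>\<alpha>. norm (cps_coeff f \<alpha>) * r ^ vdeg \<alpha>)"

lemma cps_conv_pos: "cps_conv f r \<Longrightarrow> 0 < r"
  by (simp add: cps_conv_def)

lemma cps_conv_shrink: "cps_conv f r \<Longrightarrow> 0 < r' \<Longrightarrow> r' \<le> r \<Longrightarrow> cps_conv f r'"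
  unfolding cps_conv_def using ps_convergent_shrink[of "cps_coeff f" r r'] by blast

lemma cps_conv_ex: "\<exists>r. cps_conv f r"
  using cps_coeff[of f] by (auto simp: ps_convergent_def cps_conv_def)

lemma cps_conv_ex_uniform:
  fixes F :: "'i::finite \<Rightarrow> 'v::finite cps"
  shows "\<exists>r. \<forall>i. cps_conv (F i) r"
proof -
  have "\<forall>i. \<exists>r. cps_conv (F i) r" using cps_conv_ex by blast
  then obtain r where r: "\<And>i. cps_conv (F i) (r i)" by metis
  have "cps_conv (F i) (Min (range r))" for i
    by (rule cps_conv_shrink[OF r]) (use cps_conv_pos[OF r] in auto)
  then show ?thesis by blast
qed

lemma norm_monom_value_le:
  fixes x :: "complex ^ 'v::finite"
  assumes "\<And>i. norm (x $ i) \<le> r"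
  shows "norm (monom_value x \<alpha>) \<le> r ^ vdeg \<alpha>"
proof -
  have "norm (monom_value x \<alpha>) = (\<Prod>i\<in>UNIV. norm (x $ i) ^ (\<alpha> $ i))"
    by (simp add: norm_power flip: prod_norm)
  also have "\<dots> \<le> (\<Prod>i\<in>UNIV. r ^ (\<alpha> $ i))"
    by (rule prod_mono) (simp add: assms power_mono)
  also have "\<dots> = r ^ vdeg \<alpha>" by (simp add: power_sum)
  finally show ?thesis .
qed

lemma monom_value_add: "monom_value x (\<alpha> + \<beta>) = monom_value x \<alpha> * monom_value x \<beta>"
  by (simp add: power_add prod.distrib)

lemma cps_terms_abs_summable:
  assumes "cps_conv f r" "\<And>i. norm (x $ i) \<le> r"
  shows "(\<lambda>\<alpha>. cps_coeff f \<alpha> * monom_value x \<alpha>) abs_summable_on UNIV"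
  by (rule Infinite_Sum.abs_summable_on_comparison_test'[of "\<lambda>\<alpha>. norm (cps_coeff f \<alpha>) * r ^ vdeg \<alpha>"])
     (use assms norm_monom_value_le[OF assms(2)] in \<open>auto simp: cps_conv_def norm_mult intro!: mult_left_mono\<close>)

lemma norm_cps_eval_le:
  assumes "cps_conv f r" "\<And>i. norm (x $ i) \<le> r"
  shows "norm (cps_eval f x) \<le> cps_norm f r"
proof -
  have "norm (cps_eval f x) \<le> (\<Sum>\<^sub>\<infinity>\<alpha>. norm (cps_coeff f \<alpha> * monom_value x \<alpha>))"
    unfolding cps_eval_def by (rule norm_infsum_bound[OF cps_terms_abs_summable[OF assms]])
  also have "\<dots> \<le> cps_norm f r"
    unfolding cps_norm_def
    by (rule infsum_mono)
       (use assms cps_terms_abs_summable[OF assms] norm_monom_value_le[OF assms(2)]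
        in \<open>auto simp: cps_conv_def norm_mult intro!: mult_left_mono\<close>)
  finally show ?thesis .
qed

lemma cps_norm_nonneg: "0 < r \<Longrightarrow> 0 \<le> cps_norm f r"
  unfolding cps_norm_def by (rule infsum_nonneg) simp

lemma eventually_small_coords:
  assumes "0 < r"
  shows "\<forall>\<^sub>F x in nhds (0 :: complex ^ 'v::finite). \<forall>i. norm (x $ i) \<le> r"
proof -
  have "norm (x $ i) \<le> r" if "dist x 0 < r" for x :: "complex ^ 'v" and i
    using that Finite_Cartesian_Product.norm_nth_le[of x i] by simp
  then show ?thesis unfolding eventually_nhds_metric using assms by blast
qed

text \<open>Absolute convergence lets the product of the sums over all pairs of exponents be regrouped
  by the sum of the two exponents.\<close>

lemma convolution_sums:
  fixes a b :: "nat ^ 'v::finite \<Rightarrow> 'c::{real_normed_field, banach}"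
  assumes a: "a abs_summable_on UNIV" and b: "b abs_summable_on UNIV"
  defines "p \<equiv> \<lambda>\<alpha>. \<Sum>(\<beta>, \<gamma>) | \<beta> + \<gamma> = \<alpha>. a \<beta> * b \<gamma>"
  shows "p summable_on UNIV" "infsum p UNIV = infsum a UNIV * infsum b UNIV"
proof -
  let ?P = "\<lambda>\<alpha>::nat^'v. {(\<beta>, \<gamma>). \<beta> + \<gamma> = \<alpha>}"
  let ?h = "\<lambda>(\<beta>, \<gamma>). a \<beta> * b \<gamma>"
  have abs: "?h abs_summable_on (UNIV \<times> UNIV)"
    unfolding Infinite_Sum.abs_summable_on_Sigma_iff
  proof (intro conjI ballI)
    show "(\<lambda>\<gamma>. case (\<beta>, \<gamma>) of (\<beta>, \<gamma>) \<Rightarrow> a \<beta> * b \<gamma>) abs_summable_on UNIV" for \<beta>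
      using b by (simp add: norm_mult summable_on_cmult_right)
    have "(\<lambda>\<beta>. norm (a \<beta>) * (\<Sum>\<^sub>\<infinity>\<gamma>. norm (b \<gamma>))) summable_on UNIV"
      using a by (rule summable_on_cmult_left)
    then show "(\<lambda>\<beta>. \<Sum>\<^sub>\<infinity>\<gamma>. norm (case (\<beta>, \<gamma>) of (\<beta>, \<gamma>) \<Rightarrow> a \<beta> * b \<gamma>)) abs_summable_on UNIV"
      using b by (simp add: norm_mult infsum_cmult_right' abs_mult infsum_nonneg)
  qed
  then have s: "?h summable_on (UNIV \<times> UNIV)" by (rule abs_summable_summable)
  have bij: "bij_betw snd (Sigma UNIV ?P) (UNIV \<times> UNIV)"
    by (rule bij_betwI[of _ _ _ "\<lambda>x. (fst x + snd x, x)"]) auto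
  have s': "(\<lambda>x. ?h (snd x)) summable_on (Sigma UNIV ?P)"
    using summable_on_reindex_bij_betw[OF bij, of ?h] s by simp
  have p: "p = (\<lambda>\<alpha>. infsum (\<lambda>y. ?h (snd (\<alpha>, y))) (?P \<alpha>))"
    by (auto simp: p_def finite_add_eq_vec)
  show "p summable_on UNIV"
    unfolding p by (rule summable_on_Sigma_banach) (use s' in \<open>simp add: case_prod_unfold\<close>)
  have "infsum p UNIV = infsum (\<lambda>x. ?h (snd x)) (Sigma UNIV ?P)"
    unfolding p by (rule infsum_Sigma_banach[OF s'])
  also have "\<dots> = infsum ?h (UNIV \<times> UNIV)"
    by (rule infsum_reindex_bij_betw[OF bij])
  also have "\<dots> = (\<Sum>\<^sub>\<infinity>\<beta>. \<Sum>\<^sub>\<infinity>\<gamma>. a \<beta> * b \<gamma>)"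
    using infsum_Sigma_banach[OF s] by simp
  also have "\<dots> = infsum a UNIV * infsum b UNIV"
    using b a by (simp add: infsum_cmult_right' infsum_cmult_left')
  finally show "infsum p UNIV = infsum a UNIV * infsum b UNIV" .
qed

lemma cps_coeff_mult: "cps_coeff (f * g) \<alpha> = (\<Sum>(\<beta>, \<gamma>) | \<beta> + \<gamma> = \<alpha>. cps_coeff f \<beta> * cps_coeff g \<gamma>)"
  by transfer simp

lemma cps_eval_mult:
  assumes "cps_conv f r" "cps_conv g r" "\<And>i. norm (x $ i) \<le> r"
  shows "cps_eval (f * g) x = cps_eval f x * cps_eval g x"
proof -
  have "cps_coeff (f * g) \<alpha> * monom_value x \<alpha> =
      (\<Sum>(\<beta>, \<gamma>) | \<beta> + \<gamma> = \<alpha>. (cps_coeff f \<beta> * monom_value x \<beta>) * (cps_coeff g \<gamma> * monom_value x \<gamma>))" for \<alpha>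
    unfolding cps_coeff_mult sum_distrib_right
    by (rule sum.cong) (auto simp: monom_value_add simp del: vector_add_component)
  then show ?thesis
    unfolding cps_eval_def
    using convolution_sums(2)[OF cps_terms_abs_summable[OF assms(1,3)] cps_terms_abs_summable[OF assms(2,3)]]
    by simp
qed

lemma cps_norm_mult:
  assumes "cps_conv f r" "cps_conv g r"
  shows "cps_conv (f * g) r" "cps_norm (f * g) r \<le> cps_norm f r * cps_norm g r"
proof -
  have r: "0 < r" by (rule cps_conv_pos[OF assms(1)])
  let ?a = "\<lambda>f \<alpha>. norm (cps_coeff f \<alpha>) * r ^ vdeg \<alpha>"
  let ?p = "\<lambda>\<alpha>. \<Sum>(\<beta>, \<gamma>) | \<beta> + \<gamma> = \<alpha>. ?a f \<beta> * ?a g \<gamma>"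
  have abs: "?a f abs_summable_on UNIV" "?a g abs_summable_on UNIV"
    using assms r by (simp_all add: cps_conv_def abs_mult)
  note conv = convolution_sums[OF abs]
  have le: "?a (f * g) \<alpha> \<le> ?p \<alpha>" for \<alpha>
  proof -
    have "?a (f * g) \<alpha> \<le> (\<Sum>(\<beta>, \<gamma>) | \<beta> + \<gamma> = \<alpha>. norm (cps_coeff f \<beta> * cps_coeff g \<gamma>)) * r ^ vdeg \<alpha>"
      unfolding cps_coeff_mult
      using r by (intro mult_right_mono) (auto simp: case_prod_unfold intro!: norm_sum)
    also have "\<dots> = ?p \<alpha>"
      unfolding sum_distrib_right
      by (rule sum.cong) (auto simp: norm_mult sum_axis_pow simp del: vector_add_component)
    finally show ?thesis .
  qed
  have s: "?a (f * g) summable_on UNIV"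
    by (rule summable_on_comparison_test[OF conv(1)]) (use le r in auto)
  then show "cps_conv (f * g) r" using r by (simp add: cps_conv_def)
  show "cps_norm (f * g) r \<le> cps_norm f r * cps_norm g r"
    unfolding cps_norm_def conv(2)[symmetric]
    by (rule infsum_mono[OF s conv(1)]) (rule le)
qed

lemma cps_monom_conv: "0 < r \<Longrightarrow> cps_conv (cps_monom \<mu>) r"
  unfolding cps_conv_def cps_monom.rep_eq
  by (auto intro!: finite_nonzero_values_imp_summable_on finite_subset[of _ "{\<mu>}"] split: if_splits)

lemma infsum_single:
  assumes "\<And>y. y \<noteq> x \<Longrightarrow> f y = 0"
  shows "infsum f UNIV = f x"
proof -
  have "infsum f UNIV = infsum f {x}"
    by (rule infsum_cong_neutral) (use assms in auto)
  then show ?thesis by simp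
qed

lemma cps_eval_monom: "cps_eval (cps_monom \<mu>) x = monom_value x \<mu>"
  unfolding cps_eval_def cps_monom.rep_eq
  by (subst infsum_single[of \<mu>]) auto

lemma cps_eval_const: "cps_eval (cps_const c) x = c"
  unfolding cps_eval_def cps_const.rep_eq
  by (subst infsum_single[of 0]) auto

lemma cps_one_eq: "1 = cps_monom 0"
  by transfer (auto intro!: ext)

lemma cps_eval_1: "cps_eval 1 x = 1"
  by (simp add: cps_one_eq cps_eval_monom)

lemma cps_norm_1: "0 < r \<Longrightarrow> cps_norm (1 :: 'v::finite cps) r = 1"
  unfolding cps_norm_def one_cps.rep_eq
  by (subst infsum_single[of 0]) auto

lemma cps_conv_1: "0 < r \<Longrightarrow> cps_conv (1 :: 'v::finite cps) r"
  unfolding cps_one_eq by (rule cps_monom_conv)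

lemma cps_eval_add:
  assumes "cps_conv f r" "cps_conv g r" "\<And>i. norm (x $ i) \<le> r"
  shows "cps_eval (f + g) x = cps_eval f x + cps_eval g x"
  unfolding cps_eval_def plus_cps.rep_eq distrib_right
  by (rule infsum_add)
     (use abs_summable_summable[OF cps_terms_abs_summable] assms in blast)+

lemma cps_norm_power:
  assumes "cps_conv f r"
  shows "cps_conv (f ^ k) r" "cps_norm (f ^ k) r \<le> cps_norm f r ^ k"
proof (induction k)
  case (Suc k)
  have r: "0 < r" by (rule cps_conv_pos[OF assms])
  show "cps_conv (f ^ Suc k) r" using cps_norm_mult(1)[OF assms Suc(1)] by simp
  have "cps_norm (f ^ Suc k) r \<le> cps_norm f r * cps_norm (f ^ k) r"
    using cps_norm_mult(2)[OF assms Suc(1)] by simp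
  also have "\<dots> \<le> cps_norm f r * cps_norm f r ^ k"
    by (rule mult_left_mono[OF Suc(2) cps_norm_nonneg[OF r]])
  finally show "cps_norm (f ^ Suc k) r \<le> cps_norm f r ^ Suc k" by simp
qed (use cps_conv_pos[OF assms] in \<open>auto simp: cps_norm_1 cps_conv_1\<close>)

lemma cps_norm_prod:
  assumes "finite I" "0 < r" "\<And>i. i \<in> I \<Longrightarrow> cps_conv (F i) r"
  shows "cps_conv (\<Prod>i\<in>I. F i) r \<and> cps_norm (\<Prod>i\<in>I. F i) r \<le> (\<Prod>i\<in>I. cps_norm (F i) r)"
  using assms
proof (induction I rule: finite_induct)
  case (insert i I)
  then have IH: "cps_conv (\<Prod>i\<in>I. F i) r" "cps_norm (\<Prod>i\<in>I. F i) r \<le> (\<Prod>i\<in>I. cps_norm (F i) r)"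
    by auto
  have "cps_norm (F i * (\<Prod>i\<in>I. F i)) r \<le> cps_norm (F i) r * cps_norm (\<Prod>i\<in>I. F i) r"
    by (rule cps_norm_mult(2)) (use insert.prems IH in auto)
  also have "\<dots> \<le> cps_norm (F i) r * (\<Prod>i\<in>I. cps_norm (F i) r)"
    by (rule mult_left_mono[OF IH(2) cps_norm_nonneg[OF insert.prems(1)]])
  finally show ?case
    using insert cps_norm_mult(1)[OF _ IH(1), of "F i"] by simp
qed (auto simp: cps_norm_1 cps_conv_1)

lemma cps_eval_power:
  assumes "cps_conv f r" "\<And>i. norm (x $ i) \<le> r"
  shows "cps_eval (f ^ k) x = cps_eval f x ^ k"
  by (induction k) (simp_all add: cps_eval_1 cps_eval_mult[OF assms(1) cps_norm_power(1)[OF assms(1)] assms(2)])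

lemma cps_eval_prod:
  assumes "finite I" "0 < r" "\<And>i. i \<in> I \<Longrightarrow> cps_conv (F i) r" "\<And>i. norm (x $ i) \<le> r"
  shows "cps_eval (\<Prod>i\<in>I. F i) x = (\<Prod>i\<in>I. cps_eval (F i) x)"
  using assms(1,3)
proof (induction I rule: finite_induct)
  case (insert i I)
  then have "cps_conv (\<Prod>i\<in>I. F i) r" using cps_norm_prod[OF insert.hyps(1) assms(2)] by blast
  with insert show ?case
    using cps_eval_mult[of "F i" r "\<Prod>i\<in>I. F i" x] assms(4) by simp
qed (simp add: cps_eval_1)

lemma cps_norm_mono:
  assumes "cps_conv f r" "0 < r'" "r' \<le> r"
  shows "cps_norm f r' \<le> cps_norm f r"
  unfolding cps_norm_def
  by (rule infsum_mono)
     (use assms cps_conv_shrink[OF assms] in \<open>auto simp: cps_conv_def intro!: mult_left_mono power_mono\<close>)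

text \<open>A series without constant term becomes small: shrinking the radius by a factor \<open>q \<le> 1\<close>
  multiplies every term by at most \<open>q\<close>.\<close>

lemma cps_norm_small:
  assumes f: "f \<in> cps_max_ideal" and e: "0 < e"
  shows "\<exists>r. cps_conv f r \<and> cps_norm f r \<le> e"
proof -
  obtain s where s: "cps_conv f s" using cps_conv_ex by blast
  have s0: "0 < s" by (rule cps_conv_pos[OF s])
  define N where "N = cps_norm f s"
  have N: "0 \<le> N" unfolding N_def by (rule cps_norm_nonneg[OF s0])
  define q where "q = min 1 (e / (N + 1))"
  have q: "0 < q" "q \<le> 1" using e N by (auto simp: q_def)
  have conv: "cps_conv f (q * s)"
    by (rule cps_conv_shrink[OF s]) (use q s0 in \<open>auto simp: mult_le_cancel_right1\<close>)
  have le: "norm (cps_coeff f \<alpha>) * (q * s) ^ vdeg \<alpha> \<le> q * (norm (cps_coeff f \<alpha>) * s ^ vdeg \<alpha>)" for \<alpha>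
  proof (cases "\<alpha> = 0")
    case True
    then show ?thesis using f by (simp add: cps_max_ideal_def)
  next
    case False
    then have "vdeg \<alpha> \<noteq> 0" by (auto simp: Finite_Cartesian_Product.vec_eq_iff)
    then have "1 \<le> vdeg \<alpha>" by linarith
    then have "q ^ vdeg \<alpha> \<le> q ^ 1" by (rule power_decreasing) (use q in auto)
    then have "norm (cps_coeff f \<alpha>) * s ^ vdeg \<alpha> * q ^ vdeg \<alpha> \<le> norm (cps_coeff f \<alpha>) * s ^ vdeg \<alpha> * q"
      using s0 by (intro mult_left_mono) auto
    then show ?thesis by (simp add: power_mult_distrib mult_ac)
  qed
  have "cps_norm f (q * s) \<le> (\<Sum>\<^sub>\<infinity>\<alpha>. q * (norm (cps_coeff f \<alpha>) * s ^ vdeg \<alpha>))"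
    unfolding cps_norm_def
    by (rule infsum_mono) (use conv s le in \<open>auto simp: cps_conv_def intro!: summable_on_cmult_right\<close>)
  also have "\<dots> = q * N"
    unfolding N_def cps_norm_def by (rule infsum_cmult_right')
  also have "\<dots> \<le> e / (N + 1) * N" using N by (intro mult_right_mono) (auto simp: q_def)
  also have "\<dots> \<le> e" using N e by (simp add: field_simps)
  finally show ?thesis using conv by blast
qed

lemma cps_norm_small_uniform:
  fixes H :: "('v::finite cps) ^ ('w::finite)"
  assumes "\<And>j. H $ j \<in> cps_max_ideal" "0 < e"
  shows "\<exists>r. \<forall>j. cps_conv (H $ j) r \<and> cps_norm (H $ j) r \<le> e"
proof -
  have "\<forall>j. \<exists>r. cps_conv (H $ j) r \<and> cps_norm (H $ j) r \<le> e"
    using cps_norm_small assms by blast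
  then obtain r where r: "\<And>j. cps_conv (H $ j) (r j)" "\<And>j. cps_norm (H $ j) (r j) \<le> e" by metis
  let ?r = "Min (range r)"
  have m: "0 < ?r" "?r \<le> r j" for j using cps_conv_pos[OF r(1)] by auto
  have "cps_conv (H $ j) ?r \<and> cps_norm (H $ j) ?r \<le> e" for j
    using cps_conv_shrink[OF r(1) m] order_trans[OF cps_norm_mono[OF r(1) m] r(2)] by blast
  then show ?thesis by blast
qed

lemma filterlim_germ_eval:
  fixes H :: "('v::finite cps) ^ ('w::finite)"
  assumes "\<And>j. H $ j \<in> cps_max_ideal"
  shows "filterlim (germ_eval H) (nhds 0) (nhds 0)"
proof (rule vec_tendstoI)
  fix j
  show "((\<lambda>x. germ_eval H x $ j) \<longlongrightarrow> 0 $ j) (nhds 0)"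
  proof (rule tendstoI)
    fix e :: real assume e: "0 < e"
    then obtain r where r: "cps_conv (H $ j) r" "cps_norm (H $ j) r \<le> e / 2"
      using cps_norm_small[OF assms, of "e / 2" j] by auto
    show "\<forall>\<^sub>F x in nhds 0. dist (germ_eval H x $ j) (0 $ j) < e"
      using eventually_small_coords[OF cps_conv_pos[OF r(1)]]
    proof eventually_elim
      case (elim x)
      then have "norm (cps_eval (H $ j) x) \<le> cps_norm (H $ j) r" using norm_cps_eval_le[OF r(1)] by blast
      with r(2) e show ?case by (simp add: germ_eval_def)
    qed
  qed
qed


section \<open>Composition\<close>

text \<open>The coefficients are those obtained by expanding all powers of the components of \<open>H\<close>. The sums
  over \<open>\<alpha>\<close> and the resulting series converge if no component of \<open>H\<close> has a constant term.\<close>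

definition cps_comp :: "'w::finite cps \<Rightarrow> ('v::finite cps) ^ 'w \<Rightarrow> 'v cps" where
  "cps_comp F H = Abs_cps (\<lambda>\<beta>. \<Sum>\<^sub>\<infinity>\<alpha>. cps_coeff F \<alpha> * cps_coeff (monom_value H \<alpha>) \<beta>)"

lemma cps_norm_monom_value:
  fixes H :: "('v::finite cps) ^ ('w::finite)"
  assumes "\<And>j. cps_conv (H $ j) r" "\<And>j. cps_norm (H $ j) r \<le> s" "0 < r"
  shows "cps_conv (monom_value H \<alpha>) r" "cps_norm (monom_value H \<alpha>) r \<le> s ^ vdeg \<alpha>"
proof -
  have *: "cps_conv (monom_value H \<alpha>) r \<and> cps_norm (monom_value H \<alpha>) r \<le> (\<Prod>j\<in>UNIV. cps_norm (H $ j ^ (\<alpha> $ j)) r)"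
    by (rule cps_norm_prod[OF finite assms(3)]) (rule cps_norm_power(1)[OF assms(1)])
  show "cps_conv (monom_value H \<alpha>) r" using * by blast
  have "(\<Prod>j\<in>UNIV. cps_norm (H $ j ^ (\<alpha> $ j)) r) \<le> (\<Prod>j\<in>UNIV. s ^ (\<alpha> $ j))"
  proof (rule prod_mono)
    fix j :: 'w
    have "cps_norm (H $ j ^ (\<alpha> $ j)) r \<le> cps_norm (H $ j) r ^ (\<alpha> $ j)"
      by (rule cps_norm_power(2)[OF assms(1)])
    also have "\<dots> \<le> s ^ (\<alpha> $ j)" by (rule power_mono[OF assms(2) cps_norm_nonneg[OF assms(3)]])
    finally show "0 \<le> cps_norm (H $ j ^ (\<alpha> $ j)) r \<and> cps_norm (H $ j ^ (\<alpha> $ j)) r \<le> s ^ (\<alpha> $ j)"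
      using cps_norm_nonneg[OF assms(3)] by blast
  qed
  also have "\<dots> = s ^ vdeg \<alpha>" by (simp add: power_sum)
  finally show "cps_norm (monom_value H \<alpha>) r \<le> s ^ vdeg \<alpha>" using * by simp
qed

text \<open>The norms of the powers \<open>H\<^sup>\<alpha>\<close> are at most \<open>s\<^bsup>|\<alpha>|\<^esup>\<close>, so the terms of the double series of \<open>F \<circ> H\<close> are
  dominated by the norm of \<open>F\<close> at radius \<open>s\<close>. This justifies the exchanges of summation in the next two lemmas.\<close>

lemma composition_terms_summable:
  fixes H :: "('v::finite cps) ^ ('w::finite)"
  assumes F: "cps_conv F s" and H: "\<And>j. cps_conv (H $ j) r" "\<And>j. cps_norm (H $ j) r \<le> s"
  shows "(\<lambda>(\<alpha>, \<beta>). norm (cps_coeff F \<alpha> * cps_coeff (monom_value H \<alpha>) \<beta>) * r ^ vdeg \<beta>)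
    summable_on (UNIV \<times> UNIV)"
proof -
  have r: "0 < r" using cps_conv_pos[OF H(1)] .
  let ?n = "\<lambda>\<alpha>. cps_norm (monom_value H \<alpha>) r"
  note Hn = cps_norm_monom_value[OF H r]
  show ?thesis
  proof (rule summable_on_SigmaI[where g = "\<lambda>\<alpha>. norm (cps_coeff F \<alpha>) * ?n \<alpha>"])
    fix \<alpha> :: "nat ^ 'w"
    have "((\<lambda>\<beta>. norm (cps_coeff (monom_value H \<alpha>) \<beta>) * r ^ vdeg \<beta>) has_sum ?n \<alpha>) UNIV"
      unfolding cps_norm_def using Hn(1)[of \<alpha>] by (simp add: cps_conv_def)
    then have "((\<lambda>\<beta>. norm (cps_coeff F \<alpha>) * (norm (cps_coeff (monom_value H \<alpha>) \<beta>) * r ^ vdeg \<beta>))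
        has_sum norm (cps_coeff F \<alpha>) * ?n \<alpha>) UNIV"
      by (rule has_sum_cmult_right)
    then show "((\<lambda>\<beta>. case (\<alpha>, \<beta>) of (\<alpha>, \<beta>) \<Rightarrow>
        norm (cps_coeff F \<alpha> * cps_coeff (monom_value H \<alpha>) \<beta>) * r ^ vdeg \<beta>)
        has_sum norm (cps_coeff F \<alpha>) * ?n \<alpha>) UNIV"
      by (simp add: norm_mult mult_ac)
  next
    have "(\<lambda>\<alpha>. norm (cps_coeff F \<alpha>) * s ^ vdeg \<alpha>) summable_on UNIV"
      using F by (simp add: cps_conv_def)
    then show "(\<lambda>\<alpha>. norm (cps_coeff F \<alpha>) * ?n \<alpha>) summable_on UNIV"
      by (rule summable_on_comparison_test)
         (use Hn(2) cps_norm_nonneg[OF r] in \<open>auto intro!: mult_left_mono mult_nonneg_nonneg\<close>)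
  qed (use r in auto)
qed

lemma cps_coeff_comp:
  fixes H :: "('v::finite cps) ^ ('w::finite)"
  assumes "\<And>j. H $ j \<in> cps_max_ideal"
  shows "cps_coeff (cps_comp F H) \<beta> = (\<Sum>\<^sub>\<infinity>\<alpha>. cps_coeff F \<alpha> * cps_coeff (monom_value H \<alpha>) \<beta>)"
proof -
  obtain s where s: "cps_conv F s" using cps_conv_ex by blast
  obtain r where H: "\<And>j. cps_conv (H $ j) r" "\<And>j. cps_norm (H $ j) r \<le> s"
    using cps_norm_small_uniform[OF assms cps_conv_pos[OF s]] by blast
  have r: "0 < r" using cps_conv_pos[OF H(1)] .
  let ?f = "\<lambda>(\<beta>, \<alpha>). norm (cps_coeff F \<alpha> * cps_coeff (monom_value H \<alpha>) \<beta>) * r ^ vdeg \<beta>"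
  have sum: "?f summable_on (UNIV \<times> UNIV)"
    using composition_terms_summable[OF s H] summable_on_reindex_bij_betw[of prod.swap "UNIV \<times> UNIV" "UNIV \<times> UNIV" ?f]
    by (simp add: case_prod_unfold bij_betw_def)
  then have f: "?f abs_summable_on (UNIV \<times> UNIV)"
    using r by (simp add: case_prod_unfold abs_mult)
  have *: "(\<lambda>\<alpha>. cps_coeff F \<alpha> * cps_coeff (monom_value H \<alpha>) \<beta>) abs_summable_on UNIV" for \<beta>
  proof -
    have "(\<lambda>\<alpha>. norm (cps_coeff F \<alpha> * cps_coeff (monom_value H \<alpha>) \<beta>) * r ^ vdeg \<beta>) summable_on UNIV"
      using f r unfolding Infinite_Sum.abs_summable_on_Sigma_iff by (simp add: abs_mult)
    then show ?thesis
      using r by (subst (asm) summable_on_cmult_left') auto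
  qed
  have "(\<lambda>\<beta>. \<Sum>\<^sub>\<infinity>\<alpha>. norm (cps_coeff F \<alpha> * cps_coeff (monom_value H \<alpha>) \<beta>) * r ^ vdeg \<beta>) summable_on UNIV"
    by (rule summable_on_Sigma_banach) (rule sum)
  then have "(\<lambda>\<beta>. norm (\<Sum>\<^sub>\<infinity>\<alpha>. cps_coeff F \<alpha> * cps_coeff (monom_value H \<alpha>) \<beta>) * r ^ vdeg \<beta>) summable_on UNIV"
  proof (rule summable_on_comparison_test)
    fix \<beta> :: "nat ^ 'v"
    show "norm (\<Sum>\<^sub>\<infinity>\<alpha>. cps_coeff F \<alpha> * cps_coeff (monom_value H \<alpha>) \<beta>) * r ^ vdeg \<beta>
      \<le> (\<Sum>\<^sub>\<infinity>\<alpha>. norm (cps_coeff F \<alpha> * cps_coeff (monom_value H \<alpha>) \<beta>) * r ^ vdeg \<beta>)"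
      unfolding infsum_cmult_left'
      by (rule mult_right_mono[OF norm_infsum_bound[OF *]]) (use r in auto)
  qed (use r in auto)
  then have "ps_convergent (\<lambda>\<beta>. \<Sum>\<^sub>\<infinity>\<alpha>. cps_coeff F \<alpha> * cps_coeff (monom_value H \<alpha>) \<beta>)"
    unfolding ps_convergent_def using r by blast
  then show ?thesis unfolding cps_comp_def by (simp add: Abs_cps_inverse)
qed

lemma cps_eval_comp:
  fixes H :: "('v::finite cps) ^ ('w::finite)"
  assumes "\<And>j. H $ j \<in> cps_max_ideal"
  shows "\<forall>\<^sub>F x in nhds 0. cps_eval (cps_comp F H) x = cps_eval F (germ_eval H x)"
proof -
  obtain s where s: "cps_conv F s" using cps_conv_ex by blast
  obtain r where H: "\<And>j. cps_conv (H $ j) r" "\<And>j. cps_norm (H $ j) r \<le> s"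
    using cps_norm_small_uniform[OF assms cps_conv_pos[OF s]] by blast
  have r: "0 < r" using cps_conv_pos[OF H(1)] .
  show ?thesis using eventually_small_coords[OF r]
  proof eventually_elim
    case (elim x)
    then have x: "\<And>i. norm (x $ i) \<le> r" by blast
    let ?f = "\<lambda>\<alpha> \<beta>. cps_coeff F \<alpha> * cps_coeff (monom_value H \<alpha>) \<beta> * monom_value x \<beta>"
    have "(\<lambda>(\<alpha>, \<beta>). ?f \<alpha> \<beta>) abs_summable_on (UNIV \<times> UNIV)"
    proof (rule Infinite_Sum.abs_summable_on_comparison_test'[OF composition_terms_summable[OF s H]], clarify)
      fix \<alpha> :: "nat ^ 'w" and \<beta> :: "nat ^ 'v"
      show "norm (?f \<alpha> \<beta>) \<le> norm (cps_coeff F \<alpha> * cps_coeff (monom_value H \<alpha>) \<beta>) * r ^ vdeg \<beta>"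
        unfolding norm_mult[of _ "monom_value x \<beta>"]
        by (rule mult_left_mono[OF norm_monom_value_le[OF x]]) auto
    qed
    then have sum: "(\<lambda>(\<alpha>, \<beta>). ?f \<alpha> \<beta>) summable_on (UNIV \<times> UNIV)" by (rule abs_summable_summable)
    have pow: "cps_eval (monom_value H \<alpha>) x = monom_value (germ_eval H x) \<alpha>" for \<alpha>
      using cps_eval_prod[OF finite r cps_norm_power(1)[OF H(1)] x] cps_eval_power[OF H(1) x]
      by (simp add: germ_eval_def)
    have "cps_eval (cps_comp F H) x = (\<Sum>\<^sub>\<infinity>\<beta>. \<Sum>\<^sub>\<infinity>\<alpha>. ?f \<alpha> \<beta>)"
      unfolding cps_eval_def cps_coeff_comp[OF assms] infsum_cmult_left' ..
    also have "\<dots> = (\<Sum>\<^sub>\<infinity>\<alpha>. \<Sum>\<^sub>\<infinity>\<beta>. ?f \<alpha> \<beta>)"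
      by (rule infsum_swap_banach[OF sum, symmetric])
    also have "\<dots> = (\<Sum>\<^sub>\<infinity>\<alpha>. cps_coeff F \<alpha> * cps_eval (monom_value H \<alpha>) x)"
      unfolding cps_eval_def mult.assoc infsum_cmult_right' ..
    also have "\<dots> = cps_eval F (germ_eval H x)" unfolding pow by (simp add: cps_eval_def)
    finally show ?case .
  qed
qed

section \<open>The identity theorem\<close>

text \<open>Weights \<open>1, N, N\<^sup>2, \<dots>\<close> separate exponents with entries below \<open>N\<close>, by uniqueness of base \<open>N\<close> digits.\<close>

lemma separating_weights:
  fixes N :: nat
  assumes "finite V"
  shows "\<exists>w :: 'v \<Rightarrow> nat. \<forall>\<alpha> \<beta> :: 'v \<Rightarrow> nat. (\<forall>i\<in>V. \<alpha> i < N \<and> \<beta> i < N) \<longrightarrow>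
    (\<Sum>i\<in>V. w i * \<alpha> i) = (\<Sum>i\<in>V. w i * \<beta> i) \<longrightarrow> (\<forall>i\<in>V. \<alpha> i = \<beta> i)"
  using assms
proof (induction V rule: finite_induct)
  case (insert v V)
  then obtain w :: "'v \<Rightarrow> nat" where w: "\<And>\<alpha> \<beta> :: 'v \<Rightarrow> nat. (\<forall>i\<in>V. \<alpha> i < N \<and> \<beta> i < N) \<Longrightarrow>
    (\<Sum>i\<in>V. w i * \<alpha> i) = (\<Sum>i\<in>V. w i * \<beta> i) \<Longrightarrow> (\<forall>i\<in>V. \<alpha> i = \<beta> i)" by blast
  define w' where "w' i = (if i = v then 1 else N * w i)" for i
  have sum: "(\<Sum>i\<in>insert v V. w' i * \<alpha> i) = \<alpha> v + N * (\<Sum>i\<in>V. w i * \<alpha> i)" for \<alpha>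
  proof -
    have "(\<Sum>i\<in>V. w' i * \<alpha> i) = (\<Sum>i\<in>V. N * (w i * \<alpha> i))"
      by (rule sum.cong) (use insert.hyps in \<open>auto simp: w'_def\<close>)
    then show ?thesis using insert.hyps by (simp add: w'_def sum_distrib_left)
  qed
  show ?case
  proof (rule exI[of _ w'], intro allI impI)
    fix \<alpha> \<beta> :: "'v \<Rightarrow> nat"
    assume lt: "\<forall>i\<in>insert v V. \<alpha> i < N \<and> \<beta> i < N"
      and eq: "(\<Sum>i\<in>insert v V. w' i * \<alpha> i) = (\<Sum>i\<in>insert v V. w' i * \<beta> i)"
    let ?A = "\<Sum>i\<in>V. w i * \<alpha> i" and ?B = "\<Sum>i\<in>V. w i * \<beta> i"
    have e: "\<alpha> v + N * ?A = \<beta> v + N * ?B" using eq by (simp only: sum)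
    from arg_cong[OF e, of "\<lambda>k. k mod N"] lt have "\<alpha> v = \<beta> v" by simp
    then have AB: "?A = ?B" using e lt by simp
    have "\<forall>i\<in>V. \<alpha> i = \<beta> i" by (rule w[OF _ AB]) (use lt in simp)
    with \<open>\<alpha> v = \<beta> v\<close> show "\<forall>i\<in>insert v V. \<alpha> i = \<beta> i" by blast
  qed
qed simp

text \<open>Among the exponents of least total degree one is singled out by weights that separate them;
  a large multiple of the total degree makes all other exponents heavier.\<close>

lemma unique_lightest_exponent:
  fixes A :: "(nat ^ 'v::finite) set"
  assumes "A \<noteq> {}"
  shows "\<exists>w. \<exists>\<alpha>\<in>A. (\<forall>i. 0 < w i) \<and> (\<forall>\<beta>\<in>A. \<beta> \<noteq> \<alpha> \<longrightarrow> (\<Sum>i\<in>UNIV. w i * \<alpha> $ i) < (\<Sum>i\<in>UNIV. w i * \<beta> $ i))"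
proof -
  define d where "d = (LEAST k. \<exists>\<alpha>\<in>A. vdeg \<alpha> = k)"
  have "\<exists>\<alpha>\<in>A. vdeg \<alpha> = d" unfolding d_def by (rule LeastI_ex) (use assms in auto)
  then obtain \<alpha>0 where \<alpha>0: "\<alpha>0 \<in> A" "vdeg \<alpha>0 = d" by blast
  have dmin: "d \<le> vdeg \<alpha>" if "\<alpha> \<in> A" for \<alpha> unfolding d_def by (rule Least_le) (use that in blast)
  have lt: "\<alpha> $ i < Suc d" if "vdeg \<alpha> = d" for \<alpha> :: "nat ^ 'v" and i
    using member_le_sum[of i UNIV "\<lambda>i. \<alpha> $ i"] that by simp
  obtain w where w0: "\<forall>\<alpha> \<beta> :: 'v \<Rightarrow> nat. (\<forall>i\<in>UNIV. \<alpha> i < Suc d \<and> \<beta> i < Suc d) \<longrightarrow>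
    (\<Sum>i\<in>UNIV. w i * \<alpha> i) = (\<Sum>i\<in>UNIV. w i * \<beta> i) \<longrightarrow> (\<forall>i\<in>UNIV. \<alpha> i = \<beta> i)"
    using separating_weights[OF finite, of UNIV "Suc d"] by (rule exE)
  have w: "\<forall>i\<in>UNIV. \<alpha> i = \<beta> i" if "\<forall>i\<in>UNIV. \<alpha> i < Suc d \<and> \<beta> i < Suc d"
    "(\<Sum>i\<in>UNIV. w i * \<alpha> i) = (\<Sum>i\<in>UNIV. w i * \<beta> i)" for \<alpha> \<beta> :: "'v \<Rightarrow> nat"
    using w0 that by blast
  define W where "W \<alpha> = (\<Sum>i\<in>UNIV. w i * \<alpha> $ i)" for \<alpha> :: "nat ^ 'v"
  define m where "m = (LEAST k. \<exists>\<alpha>\<in>A. vdeg \<alpha> = d \<and> W \<alpha> = k)"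
  have "\<exists>\<alpha>\<in>A. vdeg \<alpha> = d \<and> W \<alpha> = m" unfolding m_def by (rule LeastI_ex) (use \<alpha>0 in auto)
  then obtain \<alpha> where \<alpha>: "\<alpha> \<in> A" "vdeg \<alpha> = d" "W \<alpha> = m" by blast
  have mmin: "m \<le> W \<beta>" if "\<beta> \<in> A" "vdeg \<beta> = d" for \<beta>
    unfolding m_def by (rule Least_le) (use that in blast)
  define u where "u i = Suc m + w i" for i
  have u: "(\<Sum>i\<in>UNIV. u i * \<beta> $ i) = Suc m * vdeg \<beta> + W \<beta>" for \<beta>
    unfolding u_def W_def distrib_right sum.distrib sum_distrib_left ..
  have "Suc m * vdeg \<alpha> + W \<alpha> < Suc m * vdeg \<beta> + W \<beta>" if \<beta>: "\<beta> \<in> A" "\<beta> \<noteq> \<alpha>" for \<beta>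
  proof (cases "vdeg \<beta> = d")
    case True
    have "W \<beta> \<noteq> W \<alpha>"
    proof
      assume "W \<beta> = W \<alpha>"
      then have "\<forall>i\<in>UNIV. \<beta> $ i = \<alpha> $ i"
        by (intro w) (use lt[OF True] lt[OF \<alpha>(2)] in \<open>auto simp: W_def\<close>)
      with \<beta>(2) show False by (simp add: Finite_Cartesian_Product.vec_eq_iff)
    qed
    then show ?thesis using mmin[OF \<beta>(1) True] \<alpha> True by simp
  next
    case False
    then have "Suc d \<le> vdeg \<beta>" using dmin[OF \<beta>(1)] by simp
    then have "Suc m * Suc d \<le> Suc m * vdeg \<beta>" by (rule mult_le_mono2)
    moreover have "Suc m * vdeg \<alpha> + W \<alpha> < Suc m * Suc d" using \<alpha>(2,3) by simp
    ultimately show ?thesis by linarith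
  qed
  then have "\<forall>\<beta>\<in>A. \<beta> \<noteq> \<alpha> \<longrightarrow> (\<Sum>i\<in>UNIV. u i * \<alpha> $ i) < (\<Sum>i\<in>UNIV. u i * \<beta> $ i)"
    unfolding u by blast
  moreover have "\<forall>i. 0 < u i" by (simp add: u_def)
  ultimately show ?thesis using \<alpha>(1) by blast
qed

text \<open>Along the curve \<open>x\<^sub>i = z\<^bsup>w\<^sub>i\<^esup>\<close> a nonzero series is asymptotic to its lightest term, hence
  nonzero.\<close>

lemma cps_eval_eq_0:
  fixes f :: "'v::finite cps"
  assumes "\<forall>\<^sub>F x in nhds 0. cps_eval f x = 0"
  shows "f = 0"
proof (rule ccontr)
  assume "f \<noteq> 0"
  then have "cps_supp f \<noteq> {}" unfolding cps_supp_def by transfer auto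
  from unique_lightest_exponent[OF this] obtain w \<alpha> where
    \<alpha>: "\<alpha> \<in> cps_supp f" and w: "\<And>i. 0 < w i"
    and light: "\<And>\<beta>. \<beta> \<in> cps_supp f \<Longrightarrow> \<beta> \<noteq> \<alpha> \<Longrightarrow> (\<Sum>i\<in>UNIV. w i * \<alpha> $ i) < (\<Sum>i\<in>UNIV. w i * \<beta> $ i)"
    by blast
  define W where "W \<beta> = (\<Sum>i\<in>UNIV. w i * \<beta> $ i)" for \<beta> :: "nat ^ 'v"
  obtain r where r: "cps_conv f r" using cps_conv_ex by blast
  define r' where "r' = min r 1"
  have r': "cps_conv f r'" by (rule cps_conv_shrink[OF r]) (use cps_conv_pos[OF r] in \<open>auto simp: r'_def\<close>)
  have r'0: "0 < r'" "r' \<le> 1" using cps_conv_pos[OF r] by (auto simp: r'_def)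
  define x where "x z = (\<chi> i. complex_of_real z ^ w i)" for z :: real
  have xs: "norm (x z $ i) \<le> r'" if "0 < z" "z \<le> r'" for z i
  proof -
    have "norm (x z $ i) = z ^ w i" using that by (simp add: x_def norm_power)
    also have "\<dots> \<le> z ^ 1" using that r'0 w[of i] by (intro power_decreasing) auto
    finally show ?thesis using that by simp
  qed
  have xW: "monom_value (x z) \<beta> = complex_of_real z ^ W \<beta>" for z \<beta>
    by (simp add: x_def W_def power_sum power_mult)
  let ?b = "\<lambda>\<beta>. cps_coeff f \<beta> * complex_of_real r' ^ W \<beta>"
  have b: "?b abs_summable_on UNIV"
    using cps_terms_abs_summable[OF r' xs[OF r'0(1) order_refl]] by (simp only: xW)
  define K where "K = (\<Sum>\<^sub>\<infinity>\<beta>. norm (?b \<beta>))"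
  have bound: "norm (cps_coeff f \<alpha>) * z ^ W \<alpha> \<le> (z / r') ^ Suc (W \<alpha>) * K"
    if z: "0 < z" "z \<le> r'" "cps_eval f (x z) = 0" for z
  proof -
    let ?a = "\<lambda>\<beta>. cps_coeff f \<beta> * complex_of_real z ^ W \<beta>"
    have a: "?a abs_summable_on UNIV"
      using cps_terms_abs_summable[OF r' xs[OF z(1,2)]] by (simp only: xW)
    have a': "?a abs_summable_on (UNIV - {\<alpha>})"
      by (rule summable_on_subset_banach[OF a]) simp
    have "cps_eval f (x z) = infsum ?a UNIV" unfolding cps_eval_def xW ..
    also have "\<dots> = infsum ?a (UNIV - {\<alpha>}) + ?a \<alpha>"
      using infsum_Un_disjoint[of ?a "UNIV - {\<alpha>}" "{\<alpha>}"] abs_summable_summable[OF a'] by (simp add: Un_commute)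
    finally have "infsum ?a (UNIV - {\<alpha>}) + ?a \<alpha> = 0" using z(3) by (rule trans[OF sym])
    then have "?a \<alpha> = - infsum ?a (UNIV - {\<alpha>})" by (rule add_eq_0_iff[THEN iffD1])
    then have "norm (?a \<alpha>) = norm (infsum ?a (UNIV - {\<alpha>}))" by (simp only: norm_minus_cancel)
    also have "\<dots> \<le> (\<Sum>\<^sub>\<infinity>\<beta>\<in>UNIV - {\<alpha>}. norm (?a \<beta>))" by (rule norm_infsum_bound[OF a'])
    also have "\<dots> \<le> (\<Sum>\<^sub>\<infinity>\<beta>. (z / r') ^ Suc (W \<alpha>) * norm (?b \<beta>))"
    proof (rule infsum_mono_neutral)
      show "(\<lambda>\<beta>. (z / r') ^ Suc (W \<alpha>) * norm (?b \<beta>)) summable_on UNIV"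
        by (rule summable_on_cmult_right) (rule b)
    next
      fix \<beta> assume "\<beta> \<in> (UNIV - {\<alpha>}) \<inter> UNIV"
      show "norm (?a \<beta>) \<le> (z / r') ^ Suc (W \<alpha>) * norm (?b \<beta>)"
      proof (cases "cps_coeff f \<beta> = 0")
        case False
        then have "Suc (W \<alpha>) \<le> W \<beta>"
          using light[of \<beta>] \<open>\<beta> \<in> _\<close> by (auto simp: cps_supp_def W_def)
        then have "(z / r') ^ W \<beta> \<le> (z / r') ^ Suc (W \<alpha>)"
          using z r'0 by (intro power_decreasing) auto
        then have "(z / r') ^ W \<beta> * (norm (cps_coeff f \<beta>) * r' ^ W \<beta>) \<le> (z / r') ^ Suc (W \<alpha>) * (norm (cps_coeff f \<beta>) * r' ^ W \<beta>)"
          using r'0 by (intro mult_right_mono) auto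
        then show ?thesis using z r'0 by (simp add: norm_mult norm_power power_divide mult_ac)
      qed simp
    qed (use a' z r'0 in auto)
    also have "\<dots> = (z / r') ^ Suc (W \<alpha>) * K" unfolding K_def by (rule infsum_cmult_right')
    finally show ?thesis using z by (simp add: norm_mult norm_power)
  qed
  have lim: "filterlim x (nhds 0) (at_right 0)"
  proof (rule vec_tendstoI)
    fix i
    have "((\<lambda>z. complex_of_real z ^ w i) \<longlongrightarrow> complex_of_real 0 ^ w i) (at_right 0)"
      by (intro tendsto_intros)
    then show "((\<lambda>z. x z $ i) \<longlongrightarrow> 0 $ i) (at_right 0)"
      using w[of i] by (simp add: x_def zero_power)
  qed
  have ev: "\<forall>\<^sub>F z in at_right 0. norm (cps_coeff f \<alpha>) \<le> z * (K / r' ^ Suc (W \<alpha>))"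
    using eventually_compose_filterlim[OF assms lim] eventually_at_right_real[OF r'0(1)]
  proof eventually_elim
    case (elim z)
    then have z: "0 < z" "z \<le> r'" by auto
    have "norm (cps_coeff f \<alpha>) * z ^ W \<alpha> \<le> (z * (K / r' ^ Suc (W \<alpha>))) * z ^ W \<alpha>"
      using bound[OF z elim(1)] by (simp add: power_divide mult_ac)
    then show ?case by (rule mult_right_le_imp_le) (use z in simp)
  qed
  have "((\<lambda>z. z * (K / r' ^ Suc (W \<alpha>))) \<longlongrightarrow> 0 * (K / r' ^ Suc (W \<alpha>))) (at_right 0)"
    by (intro tendsto_intros)
  then have "norm (cps_coeff f \<alpha>) \<le> 0 * (K / r' ^ Suc (W \<alpha>))"
    by (rule tendsto_lowerbound[OF _ ev]) simp
  with \<alpha> show False by (simp add: cps_supp_def)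
qed

lemma eventually_cps_eval_mult:
  "\<forall>\<^sub>F x in nhds 0. cps_eval (f * g) x = cps_eval f x * cps_eval g x"
proof -
  obtain r where r: "\<And>b. cps_conv (if b then f else g) r"
    using cps_conv_ex_uniform[of "\<lambda>b. if b then f else g"] by blast
  have fg: "cps_conv f r" "cps_conv g r" using r[of True] r[of False] by simp_all
  show ?thesis using eventually_small_coords[OF cps_conv_pos[OF fg(1)]]
    by eventually_elim (use cps_eval_mult[OF fg] in blast)
qed

lemma eventually_cps_eval_add:
  "\<forall>\<^sub>F x in nhds 0. cps_eval (f + g) x = cps_eval f x + cps_eval g x"
proof -
  obtain r where r: "\<And>b. cps_conv (if b then f else g) r"
    using cps_conv_ex_uniform[of "\<lambda>b. if b then f else g"] by blast
  have fg: "cps_conv f r" "cps_conv g r" using r[of True] r[of False] by simp_all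
  show ?thesis using eventually_small_coords[OF cps_conv_pos[OF fg(1)]]
    by eventually_elim (use cps_eval_add[OF fg] in blast)
qed

lemma cps_eqI:
  assumes "\<forall>\<^sub>F x in nhds 0. cps_eval f x = cps_eval g x"
  shows "f = g"
proof -
  have "\<forall>\<^sub>F x in nhds 0. cps_eval (f - g) x = 0"
    using assms eventually_cps_eval_add[of "f - g" g] by eventually_elim simp
  then have "f - g = 0" by (rule cps_eval_eq_0)
  then show ?thesis by simp
qed

section \<open>Supports of products and roots\<close>

lemma vec_le_iff: "(\<alpha> :: nat ^ 'v::finite) \<le> \<beta> \<longleftrightarrow> (\<forall>i. \<alpha> $ i \<le> \<beta> $ i)"
  by (simp add: Finite_Cartesian_Product.less_eq_vec_def)

lemma vec_less_iff: "(\<alpha> :: nat ^ 'v::finite) < \<beta> \<longleftrightarrow> \<alpha> \<le> \<beta> \<and> \<alpha> \<noteq> \<beta>"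
  by (rule order.strict_iff_order)

lemma vdeg_strict_mono:
  assumes "(\<alpha> :: nat ^ 'v::finite) < \<beta>"
  shows "vdeg \<alpha> < vdeg \<beta>"
proof -
  have "\<forall>i. \<alpha> $ i \<le> \<beta> $ i" "\<exists>i. \<alpha> $ i \<noteq> \<beta> $ i"
    using assms by (auto simp: vec_less_iff vec_le_iff Finite_Cartesian_Product.vec_eq_iff)
  then show ?thesis
    by (intro sum_strict_mono_ex1) (auto intro: le_neq_implies_less)
qed

lemma vec_add_le_left: "(\<alpha> :: nat ^ 'v::finite) \<le> \<alpha> + \<beta>" "(\<beta> :: nat ^ 'v::finite) \<le> \<alpha> + \<beta>"
  by (simp_all add: vec_le_iff)

lemma vec_le_addE:
  assumes "(\<alpha> :: nat ^ 'v::finite) \<le> \<beta>"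
  obtains \<gamma> where "\<beta> = \<alpha> + \<gamma>"
proof
  show "\<beta> = \<alpha> + (\<chi> i. \<beta> $ i - \<alpha> $ i)"
    using assms by (simp add: vec_le_iff Finite_Cartesian_Product.vec_eq_iff)
qed

lemma cps_coeff_simps [simp]:
  "cps_coeff (cps_monom \<mu>) \<alpha> = (if \<alpha> = \<mu> then 1 else 0)"
  "cps_coeff (cps_const c) \<alpha> = (if \<alpha> = 0 then c else 0)"
  "cps_coeff (f + g) \<alpha> = cps_coeff f \<alpha> + cps_coeff g \<alpha>"
  "cps_coeff 1 \<alpha> = (if \<alpha> = 0 then 1 else 0)"
  by (simp_all add: cps_monom.rep_eq cps_const.rep_eq plus_cps.rep_eq one_cps.rep_eq)

lemma cps_coeff_mult_0 [simp]: "cps_coeff (f * g) 0 = cps_coeff f 0 * cps_coeff g 0"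
proof -
  have "{(\<beta>, \<gamma>). \<beta> + \<gamma> = (0 :: nat ^ 'a)} = {(0, 0)}"
    by (auto simp: Finite_Cartesian_Product.vec_eq_iff)
  then show ?thesis by (simp add: cps_coeff_mult)
qed

lemma cps_coeff_power_0 [simp]: "cps_coeff (f ^ k) 0 = cps_coeff f 0 ^ k"
  by (induction k) simp_all

lemma cps_coeff_prod_0 [simp]: "cps_coeff (\<Prod>i\<in>I. F i) 0 = (\<Prod>i\<in>I. cps_coeff (F i) 0)"
  by (induction I rule: infinite_finite_induct) simp_all

lemma cps_coeff_monom_mult: "cps_coeff (cps_monom \<mu> * f) (\<mu> + \<beta>) = cps_coeff f \<beta>"
proof -
  have "cps_coeff (cps_monom \<mu> * f) (\<mu> + \<beta>) =
      (\<Sum>(\<beta>', \<gamma>) \<in> {(\<mu>, \<beta>)}. cps_coeff (cps_monom \<mu>) \<beta>' * cps_coeff f \<gamma>)"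
    unfolding cps_coeff_mult
    by (rule sum.mono_neutral_right) (auto simp: finite_add_eq_vec split: if_splits)
  then show ?thesis by simp
qed

lemma cps_coeff_mult_nz:
  assumes "cps_coeff (f * g) \<alpha> \<noteq> 0"
  obtains \<beta> \<gamma> where "\<alpha> = \<beta> + \<gamma>" "cps_coeff f \<beta> \<noteq> 0" "cps_coeff g \<gamma> \<noteq> 0"
proof -
  from assms obtain x where "x \<in> {(\<beta>, \<gamma>). \<beta> + \<gamma> = \<alpha>}"
    "(case x of (\<beta>, \<gamma>) \<Rightarrow> cps_coeff f \<beta> * cps_coeff g \<gamma>) \<noteq> 0"
    unfolding cps_coeff_mult by (rule sum.not_neutral_contains_not_neutral)
  then show ?thesis by (intro that[of "fst x" "snd x"]) auto
qed

lemma cps_coeff_monom_mult_nz: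
  assumes "cps_coeff (cps_monom \<mu> * f) \<alpha> \<noteq> 0"
  obtains \<beta> where "\<alpha> = \<mu> + \<beta>" "cps_coeff f \<beta> \<noteq> 0"
  using assms by (elim cps_coeff_mult_nz) (auto split: if_splits)

lemma cps_monom_add: "cps_monom (\<mu> + \<nu>) = cps_monom \<mu> * cps_monom \<nu>"
  by (rule cps_eqI, rule eventually_mono[OF eventually_cps_eval_mult[of "cps_monom \<mu>" "cps_monom \<nu>"]])
     (simp add: cps_eval_monom monom_value_add del: vector_add_component)

text \<open>Supports are only ever controlled up to a bound \<open>B\<close>, by requiring exponents to lie in a submonoid of
  \<open>\<nat>\<^sup>r\<close>; such a bound is inherited by sums, products and composites.\<close>

definition submonoid_vec :: "(nat ^ 'v::finite) set \<Rightarrow> bool" where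
  "submonoid_vec M \<longleftrightarrow> 0 \<in> M \<and> (\<forall>\<alpha>\<in>M. \<forall>\<beta>\<in>M. \<alpha> + \<beta> \<in> M)"

definition supp_upto :: "nat ^ 'v::finite \<Rightarrow> (nat ^ 'v) set \<Rightarrow> 'v cps \<Rightarrow> bool" where
  "supp_upto B M f \<longleftrightarrow> (\<forall>\<beta>\<le>B. cps_coeff f \<beta> \<noteq> 0 \<longrightarrow> \<beta> \<in> M)"

lemma supp_upto_mono: "supp_upto B M f \<Longrightarrow> B' \<le> B \<Longrightarrow> supp_upto B' M f"
  by (auto simp: supp_upto_def)

lemma supp_upto_subset: "supp_upto B M f \<Longrightarrow> M \<subseteq> M' \<Longrightarrow> supp_upto B M' f"
  by (auto simp: supp_upto_def)

lemma supp_upto_mult: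
  assumes "submonoid_vec M" "supp_upto B M f" "supp_upto B M g"
  shows "supp_upto B M (f * g)"
  unfolding supp_upto_def
proof (intro allI impI)
  fix \<alpha> assume "\<alpha> \<le> B" "cps_coeff (f * g) \<alpha> \<noteq> 0"
  then obtain \<beta> \<gamma> where "\<alpha> = \<beta> + \<gamma>" "cps_coeff f \<beta> \<noteq> 0" "cps_coeff g \<gamma> \<noteq> 0"
    by (elim cps_coeff_mult_nz)
  with assms \<open>\<alpha> \<le> B\<close> show "\<alpha> \<in> M"
    unfolding supp_upto_def submonoid_vec_def
    by (metis order_trans vec_add_le_left)
qed

lemma supp_upto_1: "submonoid_vec M \<Longrightarrow> supp_upto B M 1"
  by (simp add: supp_upto_def submonoid_vec_def)

lemma supp_upto_add: "supp_upto B M f \<Longrightarrow> supp_upto B M g \<Longrightarrow> supp_upto B M (f + g)"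
  unfolding supp_upto_def by (metis add_0 cps_coeff_simps(3))

lemma supp_upto_const: "submonoid_vec M \<Longrightarrow> supp_upto B M (cps_const c)"
  by (simp add: supp_upto_def submonoid_vec_def)

lemma supp_upto_power:
  assumes "submonoid_vec M" "supp_upto B M f"
  shows "supp_upto B M (f ^ k)"
  by (induction k) (simp_all add: supp_upto_1 supp_upto_mult assms)

lemma supp_upto_prod:
  assumes "submonoid_vec M" "\<And>i. i \<in> I \<Longrightarrow> supp_upto B M (F i)"
  shows "supp_upto B M (\<Prod>i\<in>I. F i)"
  using assms(2)
  by (induction I rule: infinite_finite_induct) (simp_all add: supp_upto_1 supp_upto_mult assms(1))

lemma supp_upto_comp:
  fixes H :: "('v::finite cps) ^ ('w::finite)"
  assumes M: "submonoid_vec M" and H: "\<And>j. H $ j \<in> cps_max_ideal" "\<And>j. supp_upto B M (H $ j)"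
  shows "supp_upto B M (cps_comp F H)"
  unfolding supp_upto_def
proof (intro allI impI, rule ccontr)
  fix \<beta> assume \<beta>: "\<beta> \<le> B" "cps_coeff (cps_comp F H) \<beta> \<noteq> 0" "\<beta> \<notin> M"
  have "supp_upto B M (monom_value H \<alpha>)" for \<alpha>
    by (intro supp_upto_prod supp_upto_power M H)
  with \<beta> have "cps_coeff (monom_value H \<alpha>) \<beta> = 0" for \<alpha> by (auto simp: supp_upto_def)
  with \<beta>(2) show False by (simp add: cps_coeff_comp[OF H(1)])
qed

lemma cps_coeff_comp_0:
  fixes H :: "('v::finite cps) ^ ('w::finite)"
  assumes "\<And>j. H $ j \<in> cps_max_ideal"
  shows "cps_coeff (cps_comp F H) 0 = cps_coeff F 0"
proof -
  have "cps_coeff F \<alpha> * cps_coeff (monom_value H \<alpha>) 0 = 0" if "\<alpha> \<noteq> 0" for \<alpha>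
  proof -
    have "\<exists>j. \<alpha> $ j \<noteq> 0" using that by (auto simp: Finite_Cartesian_Product.vec_eq_iff)
    then obtain j where "\<alpha> $ j \<noteq> 0" by blast
    moreover have "cps_coeff (H $ j) 0 = 0" using assms by (simp add: cps_max_ideal_def)
    ultimately have "\<exists>j. cps_coeff (H $ j) 0 ^ (\<alpha> $ j) = 0" by (metis zero_power neq0_conv)
    then show ?thesis by simp
  qed
  then show ?thesis unfolding cps_coeff_comp[OF assms] by (subst infsum_single[of 0]) auto
qed

definition supp_below :: "nat ^ 'v::finite \<Rightarrow> (nat ^ 'v) set \<Rightarrow> 'v cps \<Rightarrow> bool" where
  "supp_below \<beta> M f \<longleftrightarrow> (\<forall>\<gamma><\<beta>. cps_coeff f \<gamma> \<noteq> 0 \<longrightarrow> \<gamma> \<in> M)"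

lemma supp_below_iff: "supp_below \<beta> M f \<longleftrightarrow> (\<forall>\<gamma><\<beta>. supp_upto \<gamma> M f)"
  unfolding supp_below_def supp_upto_def by (meson le_less_trans order_refl)

text \<open>At the first exponent outside a submonoid, taking the coefficient behaves like a derivation: a sum
  of two smaller exponents stays inside the submonoid, so only the two extreme terms of the
  convolution contribute.\<close>

lemma cps_coeff_mult_outside:
  assumes M: "submonoid_vec M" "\<beta> \<notin> M" and f: "supp_below \<beta> M f" and g: "supp_below \<beta> M g"
  shows "cps_coeff (f * g) \<beta> = cps_coeff f \<beta> * cps_coeff g 0 + cps_coeff f 0 * cps_coeff g \<beta>"
proof -
  have \<beta>0: "\<beta> \<noteq> 0" using M by (auto simp: submonoid_vec_def)
  have "cps_coeff (f * g) \<beta> = (\<Sum>(\<gamma>, \<delta>) \<in> {(\<beta>, 0), (0, \<beta>)}. cps_coeff f \<gamma> * cps_coeff g \<delta>)"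
    unfolding cps_coeff_mult
  proof (rule sum.mono_neutral_right[OF finite_add_eq_vec])
    show "{(\<beta>, 0), (0, \<beta>)} \<subseteq> {(\<gamma>, \<delta>). \<gamma> + \<delta> = \<beta>}" by simp
    show "\<forall>x\<in>{(\<gamma>, \<delta>). \<gamma> + \<delta> = \<beta>} - {(\<beta>, 0), (0, \<beta>)}. (case x of (\<gamma>, \<delta>) \<Rightarrow> cps_coeff f \<gamma> * cps_coeff g \<delta>) = 0"
    proof
      fix x assume x: "x \<in> {(\<gamma>, \<delta>). \<gamma> + \<delta> = \<beta>} - {(\<beta>, 0), (0, \<beta>)}"
      obtain \<gamma> \<delta> where xe: "x = (\<gamma>, \<delta>)" by (cases x)
      with x have *: "\<gamma> + \<delta> = \<beta>" "\<delta> \<noteq> 0" "\<gamma> \<noteq> 0" by auto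
      then have "\<gamma> < \<beta>" "\<delta> < \<beta>" by (auto simp: vec_less_iff vec_add_le_left)
      then show "(case x of (\<gamma>, \<delta>) \<Rightarrow> cps_coeff f \<gamma> * cps_coeff g \<delta>) = 0"
        using M f g *(1) by (auto simp: xe supp_below_def submonoid_vec_def)
    qed
  qed
  with \<beta>0 show ?thesis by simp
qed

lemma cps_coeff_power_outside:
  assumes M: "submonoid_vec M" "\<beta> \<notin> M" and f: "supp_below \<beta> M f"
  shows "cps_coeff (f ^ Suc k) \<beta> = of_nat (Suc k) * cps_coeff f 0 ^ k * cps_coeff f \<beta>"
proof (induction k)
  case (Suc k)
  have "supp_below \<beta> M (f ^ Suc k)"
    using f unfolding supp_below_iff by (auto intro!: supp_upto_power M supp_upto_mult)
  from cps_coeff_mult_outside[OF M f this] Suc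
  show ?case by (simp add: algebra_simps)
qed simp

text \<open>A first exponent of \<open>f\<close> outside \<open>M\<close> would survive in \<open>f\<^sup>n\<close> with the nonzero factor \<open>n f(0)\<^bsup>n-1\<^esup>\<close>.\<close>

lemma supp_upto_root:
  assumes M: "submonoid_vec M" and fk: "supp_upto B M (f ^ n)" and n: "0 < n" and f0: "cps_coeff f 0 \<noteq> 0"
  shows "supp_upto B M f"
  unfolding supp_upto_def
proof (intro allI impI)
  obtain k where k: "n = Suc k" using n by (cases n) auto
  fix \<beta> assume "\<beta> \<le> B" "cps_coeff f \<beta> \<noteq> 0"
  then show "\<beta> \<in> M"
  proof (induction "vdeg \<beta>" arbitrary: \<beta> rule: less_induct)
    case less
    show ?case
    proof (rule ccontr)
      assume \<beta>: "\<beta> \<notin> M"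
      have "supp_below \<beta> M f"
        unfolding supp_below_def
        using less.hyps vdeg_strict_mono less.prems(1) by (meson less_le_trans less_imp_le)
      from cps_coeff_power_outside[OF M \<beta> this, of k] f0 less.prems(2)
      have "cps_coeff (f ^ Suc k) \<beta> \<noteq> 0" by (simp del: of_nat_Suc power_Suc)
      with fk less.prems(1) \<beta> show False unfolding supp_upto_def k by blast
    qed
  qed
qed


section \<open>The exponents that can occur\<close>

text \<open>The part of the semigroup \<open>\<Gamma>\<close> generated by \<open>n\<theta>\<^sub>1, \<dots>, n\<theta>\<^sub>r\<close> and the first characteristic exponent.\<close>

definition char_monoid :: "nat \<Rightarrow> nat ^ 'r::finite \<Rightarrow> (nat ^ 'r) set" where
  "char_monoid n \<mu> = {\<beta>. \<exists>k z. \<forall>i. \<beta> $ i = k * \<mu> $ i + n * z i}"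

text \<open>The exponents in the lattice \<open>Q\<^sub>1 = n\<int>\<^sup>r + \<mu>\<int>\<close>. A natural \<open>k\<close> suffices, because for \<open>n > 0\<close> the vector \<open>\<mu>\<close>
  has finite order modulo \<open>n\<int>\<^sup>r\<close>.\<close>

definition char_classes :: "nat \<Rightarrow> nat ^ 'r::finite \<Rightarrow> (nat ^ 'r) set" where
  "char_classes n \<mu> = {\<beta>. \<exists>k. \<forall>i. \<beta> $ i mod n = (k * \<mu> $ i) mod n}"

text \<open>The set \<open>\<mu> - n\<theta>\<^sub>i + \<Gamma>'\<close>, where \<open>\<Gamma>'\<close> is the monoid above; these exponents come from the term
  \<open>X\<^bsub>r+1\<^esub>\<eta>\<^sub>i\<close> of a coordinate change after division by \<open>t\<^sub>i\<^sup>n\<close>.\<close>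

definition char_shift :: "nat \<Rightarrow> nat ^ 'r::finite \<Rightarrow> 'r \<Rightarrow> (nat ^ 'r) set" where
  "char_shift n \<mu> i = {\<beta>. \<exists>\<gamma>\<in>char_monoid n \<mu>. \<beta> + axis i n = \<mu> + \<gamma>}"

lemma char_monoidI: "(\<And>i. \<beta> $ i = k * \<mu> $ i + n * z i) \<Longrightarrow> \<beta> \<in> char_monoid n \<mu>"
  unfolding char_monoid_def by blast

lemma submonoid_char_monoid: "submonoid_vec (char_monoid n \<mu>)"
  unfolding submonoid_vec_def
proof (intro conjI ballI)
  show "0 \<in> char_monoid n \<mu>" by (rule char_monoidI[of _ 0 _ _ "\<lambda>_. 0"]) simp
next
  fix \<alpha> \<beta> assume "\<alpha> \<in> char_monoid n \<mu>" "\<beta> \<in> char_monoid n \<mu>"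
  then obtain k z k' z' where "\<And>i. \<alpha> $ i = k * \<mu> $ i + n * z i" "\<And>i. \<beta> $ i = k' * \<mu> $ i + n * z' i"
    unfolding char_monoid_def by blast
  then show "\<alpha> + \<beta> \<in> char_monoid n \<mu>"
    by (intro char_monoidI[of _ "k + k'" _ _ "\<lambda>i. z i + z' i"]) (simp add: algebra_simps)
qed

lemma char_monoid_generator: "\<mu> \<in> char_monoid n \<mu>" "axis i n \<in> char_monoid n \<mu>"
proof -
  show "\<mu> \<in> char_monoid n \<mu>" by (rule char_monoidI[of _ 1 _ _ "\<lambda>_. 0"]) simp
  show "axis i n \<in> char_monoid n \<mu>"
    by (rule char_monoidI[of _ 0 _ _ "\<lambda>j. if j = i then 1 else 0"]) (simp add: axis_def)
qed

lemma submonoid_char_classes: "submonoid_vec (char_classes n \<mu>)"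
  unfolding submonoid_vec_def
proof (intro conjI ballI)
  show "0 \<in> char_classes n \<mu>" unfolding char_classes_def by (auto intro!: exI[of _ 0])
next
  fix \<alpha> \<beta> assume "\<alpha> \<in> char_classes n \<mu>" "\<beta> \<in> char_classes n \<mu>"
  then obtain k k' where "\<And>i. \<alpha> $ i mod n = (k * \<mu> $ i) mod n" "\<And>i. \<beta> $ i mod n = (k' * \<mu> $ i) mod n"
    unfolding char_classes_def by blast
  then have "\<forall>i. (\<alpha> + \<beta>) $ i mod n = ((k + k') * \<mu> $ i) mod n"
    unfolding distrib_right vector_add_component by (metis mod_add_eq)
  then show "\<alpha> + \<beta> \<in> char_classes n \<mu>" unfolding char_classes_def by blast
qed

lemma char_monoid_subset_classes: "char_monoid n \<mu> \<subseteq> char_classes n \<mu>"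
  by (fastforce simp: char_monoid_def char_classes_def)

lemma char_shift_subset_classes: "char_shift n \<mu> i \<subseteq> char_classes n \<mu>"
proof
  fix \<beta> assume "\<beta> \<in> char_shift n \<mu> i"
  then obtain k z where kz: "\<And>j. (\<beta> + axis i n) $ j = \<mu> $ j + (k * \<mu> $ j + n * z j)"
    unfolding char_shift_def char_monoid_def by force
  have "\<beta> $ j mod n = (Suc k * \<mu> $ j) mod n" for j
  proof -
    have "\<beta> $ j mod n = (\<beta> + axis i n) $ j mod n" by (simp add: axis_def)
    also have "\<dots> = (Suc k * \<mu> $ j + n * z j) mod n" unfolding kz by (simp add: add_ac)
    finally show ?thesis by simp
  qed
  then show "\<beta> \<in> char_classes n \<mu>" unfolding char_classes_def by blast
qed

text \<open>An exponent of \<open>\<mu> - n\<theta>\<^sub>i + \<Gamma>'\<close> fails to lie in \<open>\<Gamma>'\<close> only because its coordinate \<open>i\<close> is too small.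
  This determines \<open>i\<close>: of two such representations, the one with the larger multiple of \<open>\<mu>\<close> shows that
  the coordinate which the other one claims to be too small is large enough.\<close>

lemma char_shift_unique_aux:
  assumes \<beta>: "\<beta> \<notin> char_monoid n \<mu>" and ij: "i \<noteq> j"
    and i: "\<And>l. (\<beta> + axis i n) $ l = Suc k * \<mu> $ l + n * z l"
    and j: "\<And>l. (\<beta> + axis j n) $ l = Suc k' * \<mu> $ l + n * z' l"
    and k: "k \<le> k'"
  shows False
proof -
  have "\<beta> $ i = Suc k' * \<mu> $ i + n * z' i" using j[of i] ij by (simp add: axis_def)
  then have "Suc k * \<mu> $ i \<le> \<beta> $ i" using k mult_le_mono1[of "Suc k" "Suc k'" "\<mu> $ i"] by linarith
  moreover have *: "\<beta> $ i + n = Suc k * \<mu> $ i + n * z i" using i[of i] by (simp add: axis_def)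
  ultimately have "n \<le> n * z i" by linarith
  then have z: "n = 0 \<or> 1 \<le> z i" by auto
  have "\<beta> \<in> char_monoid n \<mu>"
  proof (rule char_monoidI[of _ "Suc k" _ _ "\<lambda>l. if l = i then z i - 1 else z l"])
    fix l
    show "\<beta> $ l = Suc k * \<mu> $ l + n * (if l = i then z i - 1 else z l)"
    proof (cases "l = i")
      case True
      then show ?thesis using * z by (auto simp: diff_mult_distrib2)
    next
      case False
      then show ?thesis using i[of l] by (simp add: axis_def)
    qed
  qed
  with \<beta> show False by blast
qed

lemma char_shiftE:
  assumes "\<beta> \<in> char_shift n \<mu> i"
  obtains k z where "\<forall>l. (\<beta> + axis i n) $ l = Suc k * \<mu> $ l + n * z l"
proof -
  from assms obtain \<gamma> where "\<gamma> \<in> char_monoid n \<mu>" and e: "\<beta> + axis i n = \<mu> + \<gamma>"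
    unfolding char_shift_def by blast
  then obtain k z where g: "\<And>l. \<gamma> $ l = k * \<mu> $ l + n * z l" unfolding char_monoid_def by blast
  have "(\<beta> + axis i n) $ l = Suc k * \<mu> $ l + n * z l" for l unfolding e by (simp add: g)
  then show ?thesis using that by blast
qed

lemma char_shift_unique:
  assumes "\<beta> \<notin> char_monoid n \<mu>" "\<beta> \<in> char_shift n \<mu> i" "\<beta> \<in> char_shift n \<mu> j"
  shows "i = j"
proof (rule ccontr)
  assume ij: "i \<noteq> j"
  from assms(2) obtain k z where i: "\<forall>l. (\<beta> + axis i n) $ l = Suc k * \<mu> $ l + n * z l"
    by (rule char_shiftE)
  from assms(3) obtain k' z' where j: "\<forall>l. (\<beta> + axis j n) $ l = Suc k' * \<mu> $ l + n * z' l"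
    by (rule char_shiftE)
  show False
    using char_shift_unique_aux[OF assms(1) ij i[rule_format] j[rule_format]]
      char_shift_unique_aux[OF assms(1) ij[symmetric] j[rule_format] i[rule_format]]
    by linarith
qed

text \<open>If \<open>\<beta> + \<mu>\<close> were in \<open>\<Gamma>'\<close> although \<open>\<beta>\<close> is not, it would be a multiple of \<open>n\<close> in every coordinate. Since
  \<open>\<beta> = (k + 1)\<mu> - n\<theta>\<^sub>i + nz\<close>, also \<open>N\<mu>\<close> with \<open>N = k + 2\<close> is, so that \<open>\<delta>\<close> is congruent to some \<open>m\<mu>\<close> with
  \<open>m < N\<close>. As \<open>\<delta> + n\<theta>\<^sub>i \<ge> \<beta> + \<mu> + n\<theta>\<^sub>i \<ge> N\<mu> \<ge> m\<mu>\<close>, this puts \<open>\<delta>\<close> into \<open>\<Gamma>'\<close> for \<open>m \<le> 1\<close> and into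
  \<open>\<Gamma>' + 2\<mu> - n\<theta>\<^sub>i\<close> for \<open>m \<ge> 2\<close>.\<close>

lemma char_shift_plus:
  assumes n: "0 < n" and \<beta>: "\<beta> \<notin> char_monoid n \<mu>" "\<beta> \<in> char_shift n \<mu> i" and le: "\<beta> + \<mu> \<le> \<delta>"
    and \<delta>: "\<delta> \<in> char_classes n \<mu>" "\<delta> \<notin> char_monoid n \<mu>"
      "\<And>\<gamma>. \<gamma> \<in> char_monoid n \<mu> \<Longrightarrow> \<delta> + axis i n \<noteq> \<gamma> + 2 *s \<mu>"
  shows "\<beta> + \<mu> \<notin> char_monoid n \<mu>"
proof
  assume "\<beta> + \<mu> \<in> char_monoid n \<mu>"
  then obtain l y where ly: "\<And>j. \<beta> $ j + \<mu> $ j = l * \<mu> $ j + n * y j"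
    unfolding char_monoid_def by auto
  have l: "l = 0"
  proof (rule ccontr)
    assume "l \<noteq> 0"
    then obtain l' where l': "l = Suc l'" by (cases l) auto
    have "\<beta> \<in> char_monoid n \<mu>"
      by (rule char_monoidI[of _ l' _ _ y]) (use ly in \<open>simp add: l'\<close>)
    with \<beta>(1) show False by blast
  qed
  from \<beta>(2) obtain k z where kz': "\<forall>j. (\<beta> + axis i n) $ j = Suc k * \<mu> $ j + n * z j"
    by (rule char_shiftE)
  then have kz: "(\<beta> + axis i n) $ j = Suc k * \<mu> $ j + n * z j" for j by blast
  define N where "N = Suc (Suc k)"
  have N: "n * y j + axis i n $ j = N * \<mu> $ j + n * z j" for j
    using ly[of j] kz[of j] by (simp add: l N_def)
  have dvd: "n dvd N * \<mu> $ j" for j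
  proof -
    have "n dvd n * y j + axis i n $ j" by (simp add: axis_def)
    then show ?thesis unfolding N by (simp add: dvd_add_left_iff)
  qed
  from \<delta>(1) obtain m' where m': "\<And>j. \<delta> $ j mod n = (m' * \<mu> $ j) mod n"
    unfolding char_classes_def by blast
  define m where "m = m' mod N"
  have m: "\<delta> $ j mod n = (m * \<mu> $ j) mod n" for j
  proof -
    have "m' * \<mu> $ j = m * \<mu> $ j + (m' div N) * (N * \<mu> $ j)"
      unfolding m_def by (metis add.commute distrib_right div_mult_mod_eq mult.assoc)
    also have "\<dots> mod n = (m * \<mu> $ j) mod n"
      using dvd[of j] by (metis dvd_mult mod_add_right_eq add.right_neutral dvd_imp_mod_0)
    finally show ?thesis using m' by simp
  qed
  have mN: "m < N" unfolding m_def N_def by simp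
  have div: "n dvd b - a" if "b mod n = a mod n" for a b :: nat
    using that by (metis mod_eq_dvd_iff_nat nat_le_linear diff_is_0_eq dvd_0_right)
  have \<delta>le: "\<beta> $ j + \<mu> $ j \<le> \<delta> $ j" for j using le by (simp add: vec_le_iff)
  consider "m = 0" | "m = 1" | "2 \<le> m" by linarith
  then show False
  proof cases
    case 1
    have "n dvd \<delta> $ j" for j by (rule mod_0_imp_dvd) (use m[of j] 1 in simp)
    then have "\<delta> \<in> char_monoid n \<mu>"
      by (intro char_monoidI[of _ 0 _ _ "\<lambda>j. \<delta> $ j div n"]) simp
    with \<delta>(2) show False by blast
  next
    case 2
    have "\<delta> \<in> char_monoid n \<mu>"
    proof (rule char_monoidI[of _ 1 _ _ "\<lambda>j. (\<delta> $ j - \<mu> $ j) div n"])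
      fix j
      have "n dvd \<delta> $ j - \<mu> $ j" by (rule div) (use m[of j] 2 in simp)
      then show "\<delta> $ j = 1 * \<mu> $ j + n * ((\<delta> $ j - \<mu> $ j) div n)" using \<delta>le[of j] by simp
    qed
    with \<delta>(2) show False by blast
  next
    case 3
    define \<gamma> where "\<gamma> = (\<chi> j. (m - 2) * \<mu> $ j + n * (((\<delta> + axis i n) $ j - m * \<mu> $ j) div n))"
    have "\<gamma> \<in> char_monoid n \<mu>"
      by (rule char_monoidI[of _ "m - 2" _ _ "\<lambda>j. ((\<delta> + axis i n) $ j - m * \<mu> $ j) div n"]) (simp add: \<gamma>_def)
    moreover have "\<delta> + axis i n = \<gamma> + 2 *s \<mu>"
    proof (simp only: Finite_Cartesian_Product.vec_eq_iff, rule allI)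
      fix j
      have "n dvd (\<delta> + axis i n) $ j - m * \<mu> $ j"
        by (rule div) (use m[of j] m[of i] in \<open>simp add: axis_def\<close>)
      moreover have "m * \<mu> $ j \<le> (\<delta> + axis i n) $ j"
      proof -
        have "m * \<mu> $ j \<le> N * \<mu> $ j" using mN by simp
        also have "\<dots> \<le> n * y j + axis i n $ j" using N[of j] by simp
        also have "\<dots> \<le> (\<delta> + axis i n) $ j" using ly[of j] \<delta>le[of j] l by simp
        finally show ?thesis .
      qed
      ultimately have "(\<delta> + axis i n) $ j = m * \<mu> $ j + n * (((\<delta> + axis i n) $ j - m * \<mu> $ j) div n)" by simp
      moreover have "m * \<mu> $ j = (m - 2) * \<mu> $ j + 2 * \<mu> $ j"
        using 3 by (metis distrib_right le_add_diff_inverse2)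
      ultimately have "(\<delta> + axis i n) $ j = \<gamma> $ j + 2 * \<mu> $ j"
        unfolding \<gamma>_def vec_lambda_beta by linarith
      then show "(\<delta> + axis i n) $ j = (\<gamma> + 2 *s \<mu>) $ j" by simp
    qed
    ultimately show False using \<delta>(3) by blast
  qed
qed


section \<open>The forced vanishing\<close>

text \<open>
  Exponents \<open>\<delta> = B + \<mu>\<close> outside the lattice cause no difficulty, since all series involved live on the
  lattice. Otherwise exponents in \<open>char_shift n \<mu> i\<close> outside \<open>char_monoid n \<mu>\<close> are shown to be absent by
  induction: for a minimal bad \<open>\<beta>\<close>, compare the coefficient at \<open>\<beta>\<close> of \<open>P\<^sup>n\<close>, which is a multiple
  of that of \<open>P\<close> and hence \<open>0\<close>, with that of \<open>\<Prod>\<^sub>i (v\<^sub>i\<^sup>n)\<^bsup>\<mu>\<^sub>i\<^esup>\<close>, to which only one factor contributes.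
\<close>

lemma unit_factors_vanish:
  fixes v :: "'r::finite \<Rightarrow> 'r cps" and \<mu> B :: "nat ^ 'r"
  assumes n: "0 < n" and v0: "\<And>i. cps_coeff (v i) 0 \<noteq> 0"
    and \<delta>: "B + \<mu> \<notin> char_monoid n \<mu>"
      "\<And>i \<gamma>. n \<le> \<mu> $ i \<Longrightarrow> \<gamma> \<in> char_monoid n \<mu> \<Longrightarrow> B + \<mu> + axis i n \<noteq> \<gamma> + 2 *s \<mu>"
    and w1: "\<And>i. \<mu> $ i < n \<Longrightarrow> supp_upto B (char_monoid n \<mu>) (v i ^ n)"
    and w2: "\<And>i. n \<le> \<mu> $ i \<Longrightarrow> supp_upto B (char_monoid n \<mu> \<union> char_shift n \<mu> i) (v i ^ n)"
  defines "P \<equiv> \<Prod>i\<in>UNIV. v i ^ (\<mu> $ i)"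
  assumes P: "\<And>\<beta>. \<beta> < B \<Longrightarrow> \<beta> + \<mu> \<notin> char_monoid n \<mu> \<Longrightarrow> cps_coeff P \<beta> = 0"
  shows "cps_coeff P B = 0"
proof -
  let ?G = "char_monoid n \<mu>" and ?C = "char_classes n \<mu>"
  note G = submonoid_char_monoid[of n \<mu>]
  define w where "w i = v i ^ n" for i
  obtain n' where n': "n = Suc n'" using n by (cases n) auto
  have Pn: "P ^ n = (\<Prod>i\<in>UNIV. w i ^ (\<mu> $ i))"
    unfolding P_def w_def by (simp add: prod_power_distrib power_mult[symmetric] mult.commute)
  have P0: "cps_coeff P 0 \<noteq> 0" using v0 by (simp add: P_def)
  have w0: "cps_coeff (w i) 0 \<noteq> 0" for i using v0 by (simp add: w_def)
  have BG: "B \<notin> ?G"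
    using \<delta>(1) G char_monoid_generator(1) unfolding submonoid_vec_def by blast
  have wC: "supp_upto B (?G \<union> char_shift n \<mu> i) (w i)" for i
    using supp_upto_subset[OF w1[of i]] w2[of i] unfolding w_def by (cases "n \<le> \<mu> $ i") auto
  show ?thesis
  proof (cases "B \<in> ?C")
    case False
    note C = submonoid_char_classes[of n \<mu>]
    have "supp_upto B ?C (w i)" for i
      using supp_upto_subset[of B _ "w i" ?C] wC char_monoid_subset_classes char_shift_subset_classes
      by (metis Un_least)
    then have "supp_upto B ?C (P ^ n)"
      unfolding Pn by (intro supp_upto_prod supp_upto_power C)
    then have "supp_upto B ?C P" by (rule supp_upto_root[OF C _ n P0])
    with False show ?thesis by (auto simp: supp_upto_def)
  next
    case True
    have \<delta>C: "B + \<mu> \<in> ?C"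
      using True submonoid_char_classes char_monoid_generator(1) char_monoid_subset_classes
      unfolding submonoid_vec_def by blast
    have main: "\<beta> \<le> B \<Longrightarrow> \<beta> \<notin> ?G \<Longrightarrow> cps_coeff (w i) \<beta> = 0" for \<beta> i
    proof (induction "vdeg \<beta>" arbitrary: \<beta> i rule: less_induct)
      case less
      have below: "supp_upto \<gamma> ?G (w j)" if "\<gamma> < \<beta>" for \<gamma> j
        unfolding supp_upto_def
        using less.hyps[OF vdeg_strict_mono] that less.prems(1)
        by (meson le_less_trans less_le_trans less_imp_le)
      show ?case
      proof (rule ccontr)
        assume nz: "cps_coeff (w i) \<beta> \<noteq> 0"
        have i: "n \<le> \<mu> $ i"
          using w1[of i] nz less.prems unfolding w_def supp_upto_def by (meson not_le)
        have shift: "\<beta> \<in> char_shift n \<mu> j" if "cps_coeff (w j) \<beta> \<noteq> 0" for j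
          using wC[of j] that less.prems unfolding supp_upto_def by blast
        have other: "supp_upto \<beta> ?G (w j)" if "j \<noteq> i" for j
        proof -
          have "cps_coeff (w j) \<beta> = 0"
            using shift[OF nz] shift[of j] char_shift_unique[OF less.prems(2)] that by blast
          then show ?thesis
            using below unfolding supp_upto_def by (metis order_refl order_le_less)
        qed
        (* Equality would be the case excluded by the second hypothesis on B + \<mu>. *)
        have "\<beta> \<noteq> B"
        proof
          assume "\<beta> = B"
          with shift[OF nz] obtain \<gamma> where "\<gamma> \<in> ?G" "B + axis i n = \<mu> + \<gamma>"
            unfolding char_shift_def by blast
          moreover from this have "B + \<mu> + axis i n = \<gamma> + 2 *s \<mu>"
            by (simp add: Finite_Cartesian_Product.vec_eq_iff)
          ultimately show False using \<delta>(2)[OF i] by blast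
        qed
        with less.prems have lt: "\<beta> < B" by simp
        have "\<beta> + \<mu> \<notin> ?G"
          by (rule char_shift_plus[OF n less.prems(2) shift[OF nz] _ \<delta>C \<delta>(1)])
             (use less.prems(1) \<delta>(2)[OF i] in \<open>auto simp: vec_le_iff\<close>)
        with P lt have P\<beta>: "cps_coeff P \<beta> = 0" by blast
        define R where "R = (\<Prod>j\<in>UNIV - {i}. w j ^ (\<mu> $ j))"
        have PR: "P ^ n = w i ^ (\<mu> $ i) * R"
          unfolding Pn R_def by (rule prod.remove) auto
        have R: "supp_upto \<beta> ?G R"
          unfolding R_def using other by (intro supp_upto_prod supp_upto_power G) auto
        then have R\<beta>: "cps_coeff R \<beta> = 0" using less.prems(2) by (auto simp: supp_upto_def)
        have R0: "cps_coeff R 0 \<noteq> 0" using w0 by (simp add: R_def)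
        have Rb: "supp_below \<beta> ?G R"
          unfolding supp_below_iff using supp_upto_mono[OF R] by (simp add: less_imp_le)
        have wb: "supp_below \<beta> ?G (w i)" unfolding supp_below_iff using below by blast
        have wpb: "supp_below \<beta> ?G (w i ^ k)" for k
          unfolding supp_below_iff using below by (intro allI impI supp_upto_power G)
        have Pb: "supp_below \<beta> ?G P"
          unfolding supp_below_iff
        proof (intro allI impI)
          fix \<gamma> assume "\<gamma> < \<beta>"
          then have "supp_upto \<gamma> ?G (P ^ n)"
            unfolding Pn by (intro supp_upto_prod supp_upto_power G below)
          then show "supp_upto \<gamma> ?G P" by (rule supp_upto_root[OF G _ n P0])
        qed
        obtain k where k: "\<mu> $ i = Suc k" using i n by (cases "\<mu> $ i") auto
        have "0 = cps_coeff (P ^ n) \<beta>"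
          using cps_coeff_power_outside[OF G less.prems(2) Pb, of n'] P\<beta> by (simp add: n')
        also have "\<dots> = cps_coeff (w i ^ Suc k) \<beta> * cps_coeff R 0"
          unfolding PR k cps_coeff_mult_outside[OF G less.prems(2) wpb Rb] R\<beta> by simp
        also have "\<dots> = of_nat (Suc k) * cps_coeff (w i) 0 ^ k * cps_coeff (w i) \<beta> * cps_coeff R 0"
          unfolding cps_coeff_power_outside[OF G less.prems(2) wb] ..
        finally show False using w0[of i] R0 nz by (simp del: of_nat_Suc)
      qed
    qed
    then have "supp_upto B ?G (w i)" for i unfolding supp_upto_def by blast
    then have "supp_upto B ?G (P ^ n)"
      unfolding Pn by (intro supp_upto_prod supp_upto_power G)
    then have "supp_upto B ?G P" by (rule supp_upto_root[OF G _ n P0])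
    with BG show ?thesis by (auto simp: supp_upto_def)
  qed
qed

section \<open>Equivalence as an identity of power series\<close>

lemma cps_comp_mult:
  assumes "\<And>j. H $ j \<in> cps_max_ideal"
  shows "cps_comp (f * g) H = cps_comp f H * cps_comp g H"
  by (rule cps_eqI)
     (use eventually_compose_filterlim[OF eventually_cps_eval_mult[of f g] filterlim_germ_eval[OF assms]]
        cps_eval_comp[OF assms, of f] cps_eval_comp[OF assms, of g] cps_eval_comp[OF assms, of "f * g"]
        eventually_cps_eval_mult[of "cps_comp f H" "cps_comp g H"] in eventually_elim, simp)

lemma cps_comp_add:
  assumes "\<And>j. H $ j \<in> cps_max_ideal"
  shows "cps_comp (f + g) H = cps_comp f H + cps_comp g H"
  by (rule cps_eqI)
     (use eventually_compose_filterlim[OF eventually_cps_eval_add[of f g] filterlim_germ_eval[OF assms]]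
        cps_eval_comp[OF assms, of f] cps_eval_comp[OF assms, of g] cps_eval_comp[OF assms, of "f + g"]
        eventually_cps_eval_add[of "cps_comp f H" "cps_comp g H"] in eventually_elim, simp)

lemma cps_eqI_coeff: "(\<And>\<beta>. cps_coeff f \<beta> = cps_coeff g \<beta>) \<Longrightarrow> f = g"
  by (metis cps_coeff_inject ext)

lemma cps_comp_monom:
  assumes "\<And>j. H $ j \<in> cps_max_ideal"
  shows "cps_comp (cps_monom \<nu>) H = monom_value H \<nu>"
  by (rule cps_eqI_coeff, unfold cps_coeff_comp[OF assms], subst infsum_single[of \<nu>]) auto

lemma cps_comp_0:
  assumes "\<And>j. H $ j \<in> cps_max_ideal"
  shows "cps_comp 0 H = 0"
  by (rule cps_eqI_coeff) (simp add: cps_coeff_comp[OF assms] zero_cps.rep_eq)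

lemma cps_comp_const:
  assumes "\<And>j. H $ j \<in> cps_max_ideal"
  shows "cps_comp (cps_const c) H = cps_const c"
  by (rule cps_eqI, rule eventually_mono[OF cps_eval_comp[OF assms, of "cps_const c"]])
     (simp add: cps_eval_const)

lemma monom_value_axis: "monom_value H (axis j k) = H $ j ^ k"
proof -
  have "monom_value H (axis j k) = (\<Prod>i\<in>{j}. H $ i ^ (axis j k $ i))"
    by (rule prod.mono_neutral_right) (auto simp: axis_def)
  then show ?thesis by (simp add: axis_def)
qed

lemma cps_comp_var:
  assumes "\<And>j. H $ j \<in> cps_max_ideal"
  shows "cps_comp (cps_var j) H = H $ j"
  by (simp add: cps_var_def cps_comp_monom[OF assms] monom_value_axis)

lemma cps_var_power:
  fixes i :: "'v::finite"
  shows "cps_var i ^ k = cps_monom (axis i k)"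
proof (induction k)
  case 0
  have "axis i 0 = (0 :: nat ^ 'v)" by (simp add: Finite_Cartesian_Product.vec_eq_iff axis_def)
  then show ?case by (simp only: power_0 cps_one_eq)
next
  case (Suc k)
  have "axis i 1 + axis i k = axis i (Suc k)"
    by (simp add: Finite_Cartesian_Product.vec_eq_iff axis_def)
  then have "cps_monom (axis i 1) * cps_monom (axis i k) = cps_monom (axis i (Suc k))"
    by (simp only: flip: cps_monom_add)
  then show ?case by (simp only: power_Suc Suc) (simp only: cps_var_def)
qed

lemma prod_var_power: "(\<Prod>i\<in>UNIV. cps_var i ^ (\<alpha> $ i)) = cps_monom \<alpha>"
proof -
  have "(\<Prod>i\<in>I. cps_monom (\<beta> i)) = cps_monom (\<Sum>i\<in>I. \<beta> i)" if "finite I" for I :: "'a set" and \<beta> :: "'a \<Rightarrow> nat ^ 'a"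
    using that by (induction I rule: finite_induct) (simp_all add: cps_one_eq cps_monom_add)
  from this[OF finite] have "(\<Prod>i\<in>UNIV. cps_var i ^ (\<alpha> $ i)) = cps_monom (\<Sum>i\<in>UNIV. axis i (\<alpha> $ i))"
    by (simp add: cps_var_power)
  also have "(\<Sum>i\<in>UNIV. axis i (\<alpha> $ i)) = \<alpha>"
    by (simp add: Finite_Cartesian_Product.vec_eq_iff axis_def)
  finally show ?thesis .
qed

lemma cps_var_max_ideal: "cps_var i \<in> cps_max_ideal"
proof -
  have "(axis i 1 :: nat ^ 'a) $ i \<noteq> 0 $ i" by simp
  then have "(0 :: nat ^ 'a) \<noteq> axis i 1" by metis
  then show ?thesis by (simp add: cps_max_ideal_def cps_var_def)
qed

lemma cps_max_ideal_mult: "f \<in> cps_max_ideal \<Longrightarrow> f * g \<in> cps_max_ideal"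
  by (simp add: cps_max_ideal_def)

lemma cps_max_ideal_power: "f \<in> cps_max_ideal \<Longrightarrow> 0 < k \<Longrightarrow> f ^ k \<in> cps_max_ideal"
  by (simp add: cps_max_ideal_def)

lemma cps_monom_nonzero: "cps_monom \<mu> \<noteq> 0"
proof
  assume "cps_monom \<mu> = 0"
  then have "cps_coeff (cps_monom \<mu>) \<mu> = cps_coeff 0 \<mu>" by simp
  then show False by (simp add: zero_cps.rep_eq)
qed

text \<open>Substituting \<open>\<rho>(t)\<close> for \<open>t\<close> turns \<open>H\<^sub>2 = \<sigma> \<circ> H\<^sub>1 \<circ> \<rho>\<^bsup>-1\<^esup>\<close> into an identity of composites that no longer
  involves the inverse, and the identity theorem makes it one of power series.\<close>

lemma A_tilde_equiv_comp:
  assumes equiv: "A_tilde_equiv n \<mu> H1 H2"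
    and H1: "\<And>j. H1 $ j \<in> cps_max_ideal"
  obtains \<sigma> \<rho> where "(\<sigma>, \<rho>) \<in> A_tilde n \<mu>" "\<And>i. \<rho> $ i \<in> cps_max_ideal"
    "\<And>j. cps_comp (H2 $ j) \<rho> = cps_comp (\<sigma> $ j) H1"
proof -
  from equiv obtain \<sigma> \<rho> \<rho>' where A: "(\<sigma>, \<rho>) \<in> A_tilde n \<mu>" and inv: "inverse_germs \<rho> \<rho>'"
    and eq: "\<forall>\<^sub>F t in nhds 0. germ_eval H2 t = germ_eval \<sigma> (germ_eval H1 (germ_eval \<rho>' t))"
    unfolding A_tilde_equiv_def by blast
  have \<rho>: "\<And>i. \<rho> $ i \<in> cps_max_ideal" and left: "\<forall>\<^sub>F x in nhds 0. germ_eval \<rho>' (germ_eval \<rho> x) = x"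
    using inv unfolding inverse_germs_def by blast+
  have "cps_comp (H2 $ j) \<rho> = cps_comp (\<sigma> $ j) H1" for j
  proof (rule cps_eqI)
    show "\<forall>\<^sub>F x in nhds 0. cps_eval (cps_comp (H2 $ j) \<rho>) x = cps_eval (cps_comp (\<sigma> $ j) H1) x"
      using cps_eval_comp[OF \<rho>, of "H2 $ j"] cps_eval_comp[OF H1, of "\<sigma> $ j"] left
        eventually_compose_filterlim[OF eq filterlim_germ_eval[OF \<rho>]]
    proof eventually_elim
      case (elim x)
      have "cps_eval (cps_comp (H2 $ j) \<rho>) x = germ_eval H2 (germ_eval \<rho> x) $ j"
        using elim(1) by (simp add: germ_eval_def)
      also have "\<dots> = germ_eval \<sigma> (germ_eval H1 x) $ j" using elim(3,4) by simp
      also have "\<dots> = cps_eval (cps_comp (\<sigma> $ j) H1) x"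
        using elim(2) by (simp add: germ_eval_def)
      finally show ?case .
    qed
  qed
  with A \<rho> show ?thesis by (rule that)
qed


section \<open>Normalized quasi-short parameterizations\<close>

text \<open>A monic polynomial of degree \<open>0\<close> is \<open>1\<close>, a unit, and not irreducible.\<close>

lemma normalized_degree_pos:
  fixes S :: "'r::{finite,linorder} cps"
  assumes "normalized n g lam S"
  shows "0 < n"
proof (rule ccontr)
  assume "\<not> 0 < n"
  moreover from assms obtain f :: "'r cps poly" where "qo_poly n f"
    unfolding normalized_def qo_parameterization_def by blast
  ultimately have f: "degree f = 0" "lead_coeff f = 1" and irr: "\<not> f dvd 1"
    unfolding qo_poly_def weierstrass_poly_def Factorial_Ring.irreducible_def by auto
  from f have "f = [:1:]" by (metis degree_0_id)
  with irr show False by simp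
qed

text \<open>Both facts come from the last normalization condition. If \<open>\<mu> \<le> n\<theta>\<^sub>i\<close> and \<open>\<mu>\<^sub>i \<ge> n\<close>, then \<open>\<mu> = n\<theta>\<^sub>i\<close>; the
  lexicographic ordering makes \<open>i\<close> the first index, and there \<open>\<mu>\<^sub>i = n\<close> is forbidden.\<close>

lemma normalized_char_exponent:
  assumes "normalized n g lam S"
  shows "lam 1 \<noteq> 0" "n \<le> lam 1 $ i \<Longrightarrow> \<not> lam 1 \<le> axis i n"
proof -
  have n: "0 < n" by (rule normalized_degree_pos[OF assms])
  have g: "1 \<le> g"
    and lex: "\<And>i j. i < j \<Longrightarrow> ord_class.lexordp_eq (map (\<lambda>k. lam k $ j) [1..<g+1]) (map (\<lambda>k. lam k $ i) [1..<g+1])"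
    and first: "(\<forall>i. i \<noteq> Min UNIV \<longrightarrow> lam 1 $ i = 0) \<Longrightarrow> lam 1 $ Min UNIV > n"
    using assms unfolding normalized_def by blast+
  show "lam 1 \<noteq> 0" using first by auto
  show "\<not> lam 1 \<le> axis i n" if i: "n \<le> lam 1 $ i"
  proof
    assume "lam 1 \<le> axis i n"
    then have le: "lam 1 $ j \<le> axis i n $ j" for j by (simp add: vec_le_iff)
    have z: "lam 1 $ j = 0" if "j \<noteq> i" for j using le[of j] that by (simp add: axis_def)
    show False
    proof (cases "i = Min UNIV")
      case True
      then have "lam 1 $ i > n" using first z by blast
      with le[of i] show False by (simp add: axis_def)
    next
      case False
      have "Min UNIV \<le> i" by (rule Min_le) simp_all
      then have lt: "Min UNIV < i" by (rule le_neq_trans) (use False in blast)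
      have "[1..<g+1] = 1 # [2..<g+1]" using g by (simp add: upt_conv_Cons numeral_2_eq_2)
      with lex[OF lt] have "lam 1 $ i \<le> lam 1 $ Min UNIV"
        by (auto simp: ord_class.lexordp_eq_simps)
      with i n z[of "Min UNIV"] lt show False by simp
    qed
  qed
qed

lemma char_monoid_subset_semigroup:
  assumes "1 \<le> g"
  shows "char_monoid n (lam 1) \<subseteq> qo_semigroup n g lam"
proof
  fix \<beta> assume "\<beta> \<in> char_monoid n (lam 1)"
  then obtain k z where kz: "\<And>i. \<beta> $ i = k * lam 1 $ i + n * z i" unfolding char_monoid_def by blast
  define d where "d i = (if i = 1 then k else 0)" for i :: nat
  have "(\<Sum>i=1..g. d i *s nu_char n lam i) = (\<Sum>i\<in>{1}. d i *s nu_char n lam i)"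
    by (rule sum.mono_neutral_right) (use assms in \<open>auto simp: d_def\<close>)
  then have 1: "(\<Sum>i=1..g. d i *s nu_char n lam i) = k *s lam 1" by (simp add: d_def)
  have 2: "(\<Sum>j\<in>UNIV. z j *s nu_axis n j) $ i = z i * n" for i
    by (simp add: nu_axis_def axis_def if_distrib cong: if_cong)
  have "\<beta> = (\<Sum>j\<in>UNIV. z j *s nu_axis n j) + (\<Sum>i=1..g. d i *s nu_char n lam i)"
    unfolding Finite_Cartesian_Product.vec_eq_iff vector_add_component 1 2 by (simp add: kz mult.commute)
  then show "\<beta> \<in> qo_semigroup n g lam" unfolding qo_semigroup_def by blast
qed

lemma quasi_short_tail:
  assumes qs: "quasi_short n g lam S" and \<delta>: "\<delta> \<in> tail_supp (lam 1) S"
  shows "\<delta> \<notin> char_monoid n (lam 1)"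
    "n \<le> lam 1 $ i \<Longrightarrow> \<gamma> \<in> char_monoid n (lam 1) \<Longrightarrow> \<delta> + axis i n \<noteq> \<gamma> + 2 *s lam 1"
proof -
  have "char_monoid n (lam 1) \<subseteq> qo_semigroup n g lam"
    using qs char_monoid_subset_semigroup unfolding quasi_short_def normalized_def by blast
  moreover have "\<delta> \<notin> qo_semigroup n g lam"
    "\<not> (\<exists>i. lam 1 $ i \<ge> n \<and> (\<exists>\<gamma>\<in>qo_semigroup n g lam. \<delta> + nu_axis n i = \<gamma> + 2 *s lam 1))"
    using qs \<delta> unfolding quasi_short_def by blast+
  ultimately show "\<delta> \<notin> char_monoid n (lam 1)"
    "n \<le> lam 1 $ i \<Longrightarrow> \<gamma> \<in> char_monoid n (lam 1) \<Longrightarrow> \<delta> + axis i n \<noteq> \<gamma> + 2 *s lam 1"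
    unfolding nu_axis_def by blast+
qed

lemma cps_coeff_monom_unit:
  assumes "cps_coeff u 0 = 1"
  shows "cps_coeff (cps_monom \<mu> * u) \<mu> = 1"
    "cps_coeff (cps_monom \<mu> * u) \<beta> \<noteq> 0 \<Longrightarrow> \<beta> = \<mu> \<or> \<beta> \<in> tail_supp \<mu> (cps_monom \<mu> * u)"
proof -
  show "cps_coeff (cps_monom \<mu> * u) \<mu> = 1" using cps_coeff_monom_mult[of \<mu> u 0] assms by simp
  assume nz: "cps_coeff (cps_monom \<mu> * u) \<beta> \<noteq> 0"
  then obtain \<gamma> where "\<beta> = \<mu> + \<gamma>" by (elim cps_coeff_monom_mult_nz)
  then have "\<mu> \<le> \<beta>" by (simp add: vec_add_le_left)
  with nz show "\<beta> = \<mu> \<or> \<beta> \<in> tail_supp \<mu> (cps_monom \<mu> * u)"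
    by (auto simp: tail_supp_def cps_supp_def)
qed

section \<open>Minimal tail exponents are shared\<close>

text \<open>Both sides of \<open>S\<^sub>2 \<circ> \<rho> = \<sigma>\<^bsub>r+1\<^esub> \<circ> H\<^sub>1\<close> are computed at \<open>\<delta>\<close>. On the left only the terms of \<open>S\<^sub>2\<close> at \<open>\<mu>\<close> and
  \<open>\<delta>\<close> contribute, by minimality; on the right no exponent below \<open>\<delta>\<close> lies outside \<open>\<Gamma>'\<close>, so that only
  the linear term in \<open>X\<^bsub>r+1\<^esub>\<close> does. Equality reads \<open>P\<^bsub>\<delta>-\<mu>\<^esub> + s\<^sub>2v(0)\<^sup>\<delta> = s\<^sub>1a\<close>, and the first summand is \<open>0\<close>.\<close>

lemma minimal_tail_exponent:
  fixes \<mu> :: "nat ^ 'r::finite" and u1 u2 :: "'r cps"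
  defines "S1 \<equiv> cps_monom \<mu> * u1" and "S2 \<equiv> cps_monom \<mu> * u2"
  assumes n: "0 < n" and u: "cps_coeff u1 0 = 1" "cps_coeff u2 0 = 1"
    and \<mu>: "\<mu> \<noteq> 0" "\<And>i. n \<le> \<mu> $ i \<Longrightarrow> \<not> \<mu> \<le> axis i n"
    and equiv: "A_tilde_equiv n \<mu> (qo_map n S1) (qo_map n S2)"
    and \<delta>\<mu>: "\<mu> < \<delta>"
    and min: "\<And>\<beta>. \<beta> \<in> tail_supp \<mu> S1 \<union> tail_supp \<mu> S2 \<Longrightarrow> \<not> \<beta> < \<delta>"
    and \<delta>: "\<delta> \<notin> char_monoid n \<mu>"
      "\<And>i \<gamma>. n \<le> \<mu> $ i \<Longrightarrow> \<gamma> \<in> char_monoid n \<mu> \<Longrightarrow> \<delta> + axis i n \<noteq> \<gamma> + 2 *s \<mu>"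
  shows "cps_coeff S1 \<delta> = 0 \<longleftrightarrow> cps_coeff S2 \<delta> = 0"
proof -
  let ?G = "char_monoid n \<mu>"
  note G = submonoid_char_monoid[of n \<mu>]
  obtain B where B: "\<delta> = \<mu> + B" using \<delta>\<mu> vec_le_addE less_imp_le by metis
  have B\<delta>: "B < \<delta>" using \<mu>(1) by (auto simp: B vec_less_iff vec_add_le_left)
  define H1 where "H1 = qo_map n S1"
  have H1N: "H1 $ None = S1" and H1S: "H1 $ Some i = cps_monom (axis i n)" for i
    by (simp_all add: H1_def qo_map_def cps_var_power)
  have S1m: "S1 \<in> cps_max_ideal"
    unfolding S1_def by (rule cps_max_ideal_mult) (use \<mu>(1) in \<open>simp add: cps_max_ideal_def\<close>)
  have H1m: "H1 $ j \<in> cps_max_ideal" for j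
    using S1m cps_max_ideal_power[OF cps_var_max_ideal n]
    by (cases j) (simp_all add: H1_def qo_map_def)

  from A_tilde_equiv_comp[OF equiv, folded H1_def, OF H1m]
  obtain \<sigma> \<rho> where A: "(\<sigma>, \<rho>) \<in> A_tilde n \<mu>" and \<rho>m: "\<And>i. \<rho> $ i \<in> cps_max_ideal"
    and eq: "\<And>j. cps_comp (qo_map n S2 $ j) \<rho> = cps_comp (\<sigma> $ j) H1" by blast
  from A obtain c \<zeta> where \<rho>: "\<And>i. c i \<noteq> 0" "\<And>i. \<zeta> i \<in> cps_max_ideal"
      "\<And>i. \<rho> $ i = cps_var i * (cps_const (c i) + \<zeta> i)"
    unfolding A_tilde_def by blast
  from A obtain a \<epsilon> \<eta> where a: "\<And>j. a j \<noteq> 0" "\<And>j. \<epsilon> j \<in> cps_max_ideal"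
    and \<sigma>: "\<And>i. \<sigma> $ Some i = cps_const (a (Some i)) * cps_var (Some i)
                + cps_var (Some i) * \<epsilon> (Some i) + cps_var None * \<eta> (Some i)"
    and \<eta>0: "\<And>i. n > \<mu> $ i \<Longrightarrow> \<eta> (Some i) = 0"
    and \<sigma>N: "\<sigma> $ None = cps_const (a None) * cps_var None + cps_var None * \<epsilon> None
          + cps_monom (\<chi> j. case j of None \<Rightarrow> 0 | Some i \<Rightarrow> nat \<lceil>real (\<mu> $ i) / real n\<rceil>) * \<eta> None"
    unfolding A_tilde_def by blast
  define v where "v i = cps_const (c i) + \<zeta> i" for i
  have v0: "cps_coeff (v i) 0 \<noteq> 0" for i
    using \<rho>(1,2)[of i] by (simp add: v_def cps_max_ideal_def)
  have \<rho>v: "\<rho> $ i = cps_var i * v i" for i using \<rho>(3) by (simp add: v_def)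
  define P where "P = (\<Prod>i\<in>UNIV. v i ^ (\<mu> $ i))"
  define E where "E j = cps_const (a j) + cps_comp (\<epsilon> j) H1" for j
  define C where "C j = cps_comp (\<eta> j) H1" for j
  define \<nu> where "\<nu> = (\<chi> j. case j of None \<Rightarrow> 0 | Some i \<Rightarrow> nat \<lceil>real (\<mu> $ i) / real n\<rceil>)"
  define X where "X = monom_value H1 \<nu>"
  note comp = cps_comp_add[OF H1m] cps_comp_mult[OF H1m] cps_comp_var[OF H1m]
    cps_comp_const[OF H1m] cps_comp_monom[OF H1m]

  have S1_nz: "\<beta> = \<mu> \<or> \<beta> \<in> tail_supp \<mu> S1" if "cps_coeff S1 \<beta> \<noteq> 0" for \<beta>
    using cps_coeff_monom_unit(2)[OF u(1), of \<mu> \<beta>] that unfolding S1_def by blast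
  have S2_nz: "\<beta> = \<mu> \<or> \<beta> \<in> tail_supp \<mu> S2" if "cps_coeff S2 \<beta> \<noteq> 0" for \<beta>
    using cps_coeff_monom_unit(2)[OF u(2), of \<mu> \<beta>] that unfolding S2_def by blast
  have S2_\<mu>: "cps_coeff S2 \<mu> = 1" unfolding S2_def by (rule cps_coeff_monom_unit(1)[OF u(2)])

  have H1_below: "supp_upto \<gamma> ?G (H1 $ j)" if \<gamma>: "\<gamma> < \<delta>" for \<gamma> j
  proof (cases j)
    case None
    have "\<beta> = \<mu>" if "\<beta> \<le> \<gamma>" "cps_coeff S1 \<beta> \<noteq> 0" for \<beta>
      using S1_nz[OF that(2)] min[of \<beta>] that(1) \<gamma> by (auto dest: le_less_trans)
    then show ?thesis using char_monoid_generator(1) by (auto simp: supp_upto_def None H1N)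
  next
    case (Some i)
    then show ?thesis using char_monoid_generator(2)[of i n \<mu>] by (simp add: supp_upto_def H1S)
  qed
  have comp_below: "supp_upto \<gamma> ?G (cps_comp F H1)" if "\<gamma> < \<delta>" for \<gamma> F
    by (rule supp_upto_comp[OF G H1m H1_below[OF that]])
  have E_below: "supp_upto \<gamma> ?G (E j)" if "\<gamma> < \<delta>" for \<gamma> j
    unfolding E_def by (intro supp_upto_add supp_upto_const G comp_below that)
  have C_below: "supp_upto \<gamma> ?G (C j)" if "\<gamma> < \<delta>" for \<gamma> j
    unfolding C_def by (rule comp_below[OF that])
  have X_supp: "supp_upto \<gamma> ?G X" for \<gamma>
    unfolding X_def
  proof (rule supp_upto_prod[OF G])
    fix j
    show "supp_upto \<gamma> ?G (H1 $ j ^ (\<nu> $ j))"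
    proof (cases j)
      case None
      then show ?thesis by (simp add: \<nu>_def supp_upto_1[OF G])
    next
      case (Some i)
      have "supp_upto \<gamma> ?G (cps_monom (axis i n))"
        using char_monoid_generator(2)[of i n \<mu>] by (simp add: supp_upto_def)
      then show ?thesis using supp_upto_power[OF G] by (simp add: Some H1S)
    qed
  qed
  have X0: "cps_coeff X 0 = 0"
  proof -
    have "\<exists>i. \<mu> $ i \<noteq> 0" using \<mu>(1) by (auto simp: Finite_Cartesian_Product.vec_eq_iff)
    then obtain i where "\<mu> $ i \<noteq> 0" by blast
    then have "0 < \<nu> $ Some i" using n by (simp add: \<nu>_def)
    moreover have "cps_coeff (H1 $ Some i) 0 = 0" using H1m by (simp add: cps_max_ideal_def)
    ultimately have "\<exists>j. cps_coeff (H1 $ j) 0 ^ (\<nu> $ j) = 0" by (metis zero_power)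
    then show ?thesis by (simp add: X_def)
  qed

  have main: "cps_comp S2 \<rho> = S1 * E None + X * C None"
    using eq[of None] unfolding \<sigma>N \<nu>_def[symmetric]
    by (simp add: comp H1N X_def E_def C_def qo_map_def algebra_simps)
  have rhs_below: "cps_coeff (cps_comp S2 \<rho>) \<gamma> = 0" if "\<gamma> < \<delta>" "\<gamma> \<notin> ?G" for \<gamma>
  proof -
    have "supp_upto \<gamma> ?G (cps_comp S2 \<rho>)"
      unfolding main H1N[symmetric]
      by (intro supp_upto_add supp_upto_mult G X_supp E_below C_below H1_below that(1))
    with that(2) show ?thesis by (auto simp: supp_upto_def)
  qed
  have rhs: "cps_coeff (cps_comp S2 \<rho>) \<delta> = cps_coeff S1 \<delta> * a None"
  proof -
    have "cps_coeff (S1 * E None) \<delta> = cps_coeff S1 \<delta> * cps_coeff (E None) 0 + cps_coeff S1 0 * cps_coeff (E None) \<delta>"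
      by (rule cps_coeff_mult_outside[OF G \<delta>(1)])
         (use H1_below[of _ None] E_below in \<open>auto simp: supp_below_iff H1N\<close>)
    moreover have "cps_coeff (X * C None) \<delta> = cps_coeff X \<delta> * cps_coeff (C None) 0 + cps_coeff X 0 * cps_coeff (C None) \<delta>"
      by (rule cps_coeff_mult_outside[OF G \<delta>(1)])
         (use X_supp C_below in \<open>auto simp: supp_below_iff\<close>)
    moreover have "cps_coeff X \<delta> = 0" using X_supp[of \<delta>] \<delta>(1) by (auto simp: supp_upto_def)
    moreover have "cps_coeff (E None) 0 = a None"
      using a(2)[of None] by (simp add: E_def cps_coeff_comp_0[OF H1m] cps_max_ideal_def)
    moreover have "cps_coeff S1 0 = 0" using S1m by (simp add: cps_max_ideal_def)
    ultimately show ?thesis by (simp add: main X0)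
  qed

  have pow: "monom_value \<rho> \<alpha> = cps_monom \<alpha> * (\<Prod>i\<in>UNIV. v i ^ (\<alpha> $ i))" for \<alpha>
    by (simp add: \<rho>v power_mult_distrib prod.distrib prod_var_power)
  have lhs_term: "cps_coeff S2 \<alpha> * cps_coeff (monom_value \<rho> \<alpha>) \<gamma> = 0"
    if "\<gamma> \<le> \<delta>" "\<alpha> \<noteq> \<mu>" "\<alpha> \<noteq> \<delta> \<or> \<gamma> \<noteq> \<delta>" for \<alpha> \<gamma>
  proof (rule ccontr)
    assume *: "\<not> ?thesis"
    then have "\<alpha> \<in> tail_supp \<mu> S2" using S2_nz[of \<alpha>] that(2) by auto
    moreover from * have "\<alpha> \<le> \<gamma>"
      unfolding pow by (auto elim: cps_coeff_monom_mult_nz simp: vec_add_le_left)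
    ultimately show False using min[of \<alpha>] that by auto
  qed
  have lhs_below: "cps_coeff (cps_comp S2 \<rho>) (\<mu> + \<beta>) = cps_coeff P \<beta>" if "\<mu> + \<beta> < \<delta>" for \<beta>
  proof -
    have "cps_coeff (cps_comp S2 \<rho>) (\<mu> + \<beta>) = cps_coeff S2 \<mu> * cps_coeff (monom_value \<rho> \<mu>) (\<mu> + \<beta>)"
      unfolding cps_coeff_comp[OF \<rho>m] by (rule infsum_single, rule lhs_term) (use that in auto)
    then show ?thesis by (simp add: S2_\<mu> pow cps_coeff_monom_mult P_def)
  qed
  have lhs: "cps_coeff (cps_comp S2 \<rho>) \<delta> = cps_coeff P B + cps_coeff S2 \<delta> * (\<Prod>i\<in>UNIV. cps_coeff (v i) 0 ^ (\<delta> $ i))"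
  proof -
    have "cps_coeff (cps_comp S2 \<rho>) \<delta> = (\<Sum>\<^sub>\<infinity>\<alpha>\<in>{\<mu>, \<delta>}. cps_coeff S2 \<alpha> * cps_coeff (monom_value \<rho> \<alpha>) \<delta>)"
      unfolding cps_coeff_comp[OF \<rho>m] by (rule infsum_cong_neutral) (use lhs_term[OF order_refl] in auto)
    also have "\<dots> = cps_coeff S2 \<mu> * cps_coeff (monom_value \<rho> \<mu>) \<delta> + cps_coeff S2 \<delta> * cps_coeff (monom_value \<rho> \<delta>) \<delta>"
      using \<delta>\<mu> by simp
    also have "cps_coeff (monom_value \<rho> \<mu>) \<delta> = cps_coeff P B"
      unfolding pow B cps_coeff_monom_mult P_def ..
    also have "cps_coeff (monom_value \<rho> \<delta>) \<delta> = (\<Prod>i\<in>UNIV. cps_coeff (v i) 0 ^ (\<delta> $ i))"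
      using cps_coeff_monom_mult[of \<delta> _ 0] by (simp add: pow)
    finally show ?thesis by (simp add: S2_\<mu>)
  qed

  (* The component i of the equivalence; dividing it by t_i^n yields the supports of v_i^n. *)
  have unit: "cps_monom (axis i n) * v i ^ n = cps_monom (axis i n) * E (Some i) + S1 * C (Some i)" for i
  proof -
    have "cps_comp (qo_map n S2 $ Some i) \<rho> = \<rho> $ i ^ n"
      by (simp add: qo_map_def cps_var_power cps_comp_monom[OF \<rho>m] monom_value_axis)
    also have "\<dots> = cps_monom (axis i n) * v i ^ n"
      by (simp add: \<rho>v power_mult_distrib cps_var_power)
    finally show ?thesis
      using eq[of "Some i"] unfolding \<sigma>
      by (simp add: comp H1N H1S E_def C_def algebra_simps)
  qed
  have "cps_coeff P B = 0"
    unfolding P_def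
  proof (rule unit_factors_vanish[OF n v0, of B \<mu>])
    show "B + \<mu> \<notin> ?G" using \<delta>(1) by (simp add: B add.commute)
    show "B + \<mu> + axis i n \<noteq> \<gamma> + 2 *s \<mu>" if "n \<le> \<mu> $ i" "\<gamma> \<in> ?G" for i \<gamma>
      using \<delta>(2)[OF that] by (simp add: B add.commute)
    show "cps_coeff (\<Prod>i\<in>UNIV. v i ^ \<mu> $ i) \<beta> = 0" if "\<beta> < B" "\<beta> + \<mu> \<notin> ?G" for \<beta>
    proof -
      have lt: "\<mu> + \<beta> < \<delta>" using that(1) by (auto simp: B vec_less_iff vec_le_iff)
      show ?thesis using rhs_below[OF lt] lhs_below[OF lt] that(2) by (simp add: P_def add.commute)
    qed
    show "supp_upto B ?G (v i ^ n)" if i: "\<mu> $ i < n" for i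
    proof -
      have "cps_monom (axis i n) * v i ^ n = cps_monom (axis i n) * E (Some i)"
        using unit[of i] by (simp add: C_def \<eta>0[OF i] cps_comp_0[OF H1m])
      then show ?thesis using E_below[OF B\<delta>] by (simp add: cps_monom_nonzero)
    qed
    show "supp_upto B (?G \<union> char_shift n \<mu> i) (v i ^ n)" if i: "n \<le> \<mu> $ i" for i
    proof -
      have "axis i n \<le> \<mu>" using i by (simp add: vec_le_iff axis_def)
      then obtain \<mu>' where \<mu>': "\<mu> = axis i n + \<mu>'" by (rule vec_le_addE)
      have "cps_monom (axis i n) * v i ^ n = cps_monom (axis i n) * (E (Some i) + cps_monom \<mu>' * (u1 * C (Some i)))"
        unfolding unit S1_def by (subst \<mu>') (simp add: cps_monom_add algebra_simps)
      then have w: "v i ^ n = E (Some i) + cps_monom \<mu>' * (u1 * C (Some i))"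
        by (simp add: cps_monom_nonzero)
      have "supp_upto B (char_shift n \<mu> i) (cps_monom \<mu>' * (u1 * C (Some i)))"
        unfolding supp_upto_def
      proof (intro allI impI)
        fix \<beta> assume \<beta>: "\<beta> \<le> B" "cps_coeff (cps_monom \<mu>' * (u1 * C (Some i))) \<beta> \<noteq> 0"
        then obtain x y where xy: "\<beta> = \<mu>' + (x + y)" "cps_coeff u1 x \<noteq> 0" "cps_coeff (C (Some i)) y \<noteq> 0"
          by (elim cps_coeff_monom_mult_nz cps_coeff_mult_nz) blast
        have le: "\<mu>' $ j + x $ j + y $ j \<le> B $ j" for j
          using \<beta>(1) by (simp add: xy(1) vec_le_iff add.assoc)
        have "y \<le> B" unfolding vec_le_iff using le by (meson add_leE)
        then have yG: "y \<in> ?G" using C_below[OF B\<delta>] xy(3) unfolding supp_upto_def by blast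
        (* A tail term of S1 contributes only if it sits at \<delta> and \<mu> = n\<theta>_i, which is excluded. *)
        have "x = 0"
        proof (rule ccontr)
          assume x: "x \<noteq> 0"
          have "cps_coeff S1 (\<mu> + x) \<noteq> 0" using xy(2) by (simp add: S1_def cps_coeff_monom_mult)
          then have "\<mu> + x \<in> tail_supp \<mu> S1" using S1_nz[of "\<mu> + x"] x by simp
          then have "\<not> \<mu> + x < \<delta>" using min by blast
          moreover have "x \<le> B" unfolding vec_le_iff using le by (meson add_leE)
          ultimately have "x = B" by (auto simp: B vec_less_iff vec_le_iff)
          then have "\<mu>' = 0" using le by (simp add: Finite_Cartesian_Product.vec_eq_iff)
          with \<mu>' \<mu>(2)[OF i] show False by simp
        qed
        then have "\<beta> + axis i n = \<mu> + y" by (simp add: xy(1) \<mu>' add_ac)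
        with yG show "\<beta> \<in> char_shift n \<mu> i" unfolding char_shift_def by blast
      qed
      then show ?thesis
        unfolding w
        by (intro supp_upto_add supp_upto_subset[OF E_below[OF B\<delta>] Un_upper1] supp_upto_subset[OF _ Un_upper2])
    qed
  qed
  then have "cps_coeff S2 \<delta> * (\<Prod>i\<in>UNIV. cps_coeff (v i) 0 ^ (\<delta> $ i)) = cps_coeff S1 \<delta> * a None"
    using lhs rhs by simp
  with v0 a(1)[of None] show ?thesis by auto
qed

text \<open>Every element lies above a minimal element of the union, and those are assumed to be shared.\<close>

lemma minimal_elements_eqI:
  fixes T1 T2 :: "(nat ^ 'r::finite) set"
  assumes "\<And>\<delta>. \<delta> \<in> T1 \<union> T2 \<Longrightarrow> (\<And>\<beta>. \<beta> \<in> T1 \<union> T2 \<Longrightarrow> \<not> \<beta> < \<delta>) \<Longrightarrow> \<delta> \<in> T1 \<and> \<delta> \<in> T2"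
  shows "{\<delta> \<in> T1. \<not> (\<exists>\<beta>\<in>T1. \<beta> < \<delta>)} = {\<delta> \<in> T2. \<not> (\<exists>\<beta>\<in>T2. \<beta> < \<delta>)}" "T1 = {} \<longleftrightarrow> T2 = {}"
proof -
  have ex: "\<exists>\<delta>\<in>T1 \<inter> T2. \<delta> \<le> \<alpha>" if \<alpha>: "\<alpha> \<in> T1 \<union> T2" for \<alpha>
    using that
  proof (induction "vdeg \<alpha>" arbitrary: \<alpha> rule: less_induct)
    case less
    show ?case
    proof (cases "\<exists>\<beta>\<in>T1 \<union> T2. \<beta> < \<alpha>")
      case True
      then obtain \<beta> where \<beta>: "\<beta> \<in> T1 \<union> T2" "\<beta> < \<alpha>" by blast
      from less.hyps[OF vdeg_strict_mono[OF \<beta>(2)] \<beta>(1)] \<beta>(2) show ?thesis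
        by (meson less_imp_le order_trans)
    next
      case False
      then show ?thesis using assms[OF less.prems] by blast
    qed
  qed
  show "{\<delta> \<in> T1. \<not> (\<exists>\<beta>\<in>T1. \<beta> < \<delta>)} = {\<delta> \<in> T2. \<not> (\<exists>\<beta>\<in>T2. \<beta> < \<delta>)}"
    using ex by (safe; metis IntD1 IntD2 UnI1 UnI2 order_le_less order_less_le_trans)
  show "T1 = {} \<longleftrightarrow> T2 = {}" using ex by blast
qed

theorem theorem3p6:
  fixes n g :: nat
    and lam :: "nat \<Rightarrow> nat ^ 'r::{finite,linorder}"
    and S1 S2 :: "'r cps"
  assumes "quasi_short n g lam S1"
    and "quasi_short n g lam S2"
    and "A_tilde_equiv n (lam 1) (qo_map n S1) (qo_map n S2)"
  shows "zariski_exponents (lam 1) S1 = zariski_exponents (lam 1) S2"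
proof -
  let ?T1 = "tail_supp (lam 1) S1" and ?T2 = "tail_supp (lam 1) S2"
  have norm: "normalized n g lam S1" "normalized n g lam S2"
    using assms(1,2) unfolding quasi_short_def by blast+
  then obtain u1 u2 where u: "S1 = cps_monom (lam 1) * u1" "cps_coeff u1 0 = 1"
      "S2 = cps_monom (lam 1) * u2" "cps_coeff u2 0 = 1"
    unfolding normalized_def by blast
  have shared: "\<delta> \<in> ?T1 \<and> \<delta> \<in> ?T2" if \<delta>: "\<delta> \<in> ?T1 \<union> ?T2" "\<And>\<beta>. \<beta> \<in> ?T1 \<union> ?T2 \<Longrightarrow> \<not> \<beta> < \<delta>" for \<delta>
  proof -
    have lt: "lam 1 < \<delta>" using \<delta>(1) by (auto simp: tail_supp_def)
    have G: "\<delta> \<notin> char_monoid n (lam 1)"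
      using \<delta>(1) quasi_short_tail(1) assms(1,2) by blast
    have shift: "\<delta> + axis i n \<noteq> \<gamma> + 2 *s lam 1" if "n \<le> lam 1 $ i" "\<gamma> \<in> char_monoid n (lam 1)" for i \<gamma>
      using \<delta>(1) quasi_short_tail(2)[OF assms(1) _ that] quasi_short_tail(2)[OF assms(2) _ that] by blast
    have "cps_coeff S1 \<delta> = 0 \<longleftrightarrow> cps_coeff S2 \<delta> = 0"
      using minimal_tail_exponent[OF normalized_degree_pos[OF norm(1)] u(2,4)
          normalized_char_exponent[OF norm(1)], folded u(1,3), OF _ assms(3) lt \<delta>(2) G shift]
      by blast
    with \<delta>(1) lt show ?thesis by (auto simp: tail_supp_def cps_supp_def)
  qed
  have "{\<delta> \<in> ?T1. \<not> (\<exists>\<beta>\<in>?T1. \<beta> < \<delta>)} = {\<delta> \<in> ?T2. \<not> (\<exists>\<beta>\<in>?T2. \<beta> < \<delta>)}" "?T1 = {} \<longleftrightarrow> ?T2 = {}"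
    by (rule minimal_elements_eqI, rule shared; blast)+
  then show ?thesis unfolding zariski_exponents_def by (simp only:)
qed

end
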